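(* Fix integers $r,s$ with $0\le s<r$, and let $t=t(n)\ge 3$ be any sequence of integers. Then, as $n\to\infty$, $$\frac{\operatorname{mon}(C_t,G(n,r,s))}{\operatorname{hom}(C_t,G(n,r,s))}\to 1$$ if and only if $t=o\big(\min\{\sqrt{N},N_1\}\big)$, i.e. $t/\min\{\sqrt N,N_1\}\to 0$.
   Context: For integers $0\le s<r<n$, the generalized Johnson graph $G(n,r,s)$ is the simple graph whose vertices are the $r$-element subsets of $\{1,\dots,n\}$, two vertices $x,y$ being adjacent iff $|x\cap y|=s$. Here $r,s$ are constants and $n\to\infty$. Let $N=\binom{n}{r}$ be its number of vertices and $N_1=\binom{r}{s}\binom{n-r}{r-s}$ its (common) vertex degree. $C_t$ denotes the cycle on $t$ vertices. For graphs $H,G$, a homomorphism is a map $\varphi:V(H)\to V(G)$ sending edges to edges, and a monomorphism is an injective homomorphism; $\operatorname{hom}(H,G)$ and $\operatorname{mon}(H,G)$ denote their numbers. *)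

theory Defs
  imports "HOL-Analysis.Analysis"
begin

text \<open>Graphs are given by a vertex set and a (symmetric, irreflexive) adjacency relation.\<close>

definition homs :: "'a set \<Rightarrow> ('a \<Rightarrow> 'a \<Rightarrow> bool) \<Rightarrow> 'b set \<Rightarrow> ('b \<Rightarrow> 'b \<Rightarrow> bool) \<Rightarrow> ('a \<Rightarrow> 'b) set" where
  "homs VH EH VG EG = {\<phi> \<in> VH \<rightarrow>\<^sub>E VG. \<forall>u\<in>VH. \<forall>v\<in>VH. EH u v \<longrightarrow> EG (\<phi> u) (\<phi> v)}"

definition hom_count :: "'a set \<Rightarrow> ('a \<Rightarrow> 'a \<Rightarrow> bool) \<Rightarrow> 'b set \<Rightarrow> ('b \<Rightarrow> 'b \<Rightarrow> bool) \<Rightarrow> nat" where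
  "hom_count VH EH VG EG = card (homs VH EH VG EG)"

definition mon_count :: "'a set \<Rightarrow> ('a \<Rightarrow> 'a \<Rightarrow> bool) \<Rightarrow> 'b set \<Rightarrow> ('b \<Rightarrow> 'b \<Rightarrow> bool) \<Rightarrow> nat" where
  "mon_count VH EH VG EG = card {\<phi> \<in> homs VH EH VG EG. inj_on \<phi> VH}"

definition cycle_verts :: "nat \<Rightarrow> nat set" where
  "cycle_verts t = {0..<t}"

definition cycle_adj :: "nat \<Rightarrow> nat \<Rightarrow> nat \<Rightarrow> bool" where
  "cycle_adj t i j \<longleftrightarrow> i < t \<and> j < t \<and> (j = Suc i mod t \<or> i = Suc j mod t)"

definition johnson_verts :: "nat \<Rightarrow> nat \<Rightarrow> nat set set" where
  "johnson_verts n r = {x. x \<subseteq> {1..n} \<and> card x = r}"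

definition johnson_adj :: "nat \<Rightarrow> nat set \<Rightarrow> nat set \<Rightarrow> bool" where
  "johnson_adj s x y \<longleftrightarrow> card (x \<inter> y) = s"

end

theory Submission
  imports Defs
begin

text \<open>
  Let N be the number of vertices, d the degree, and p k the probability that the random walk on
  G(n,r,s) is back at its starting point after k steps. By vertex transitivity, a uniformly random
  homomorphism \<phi> of the t-cycle satisfies \<phi> a = \<phi> b with probability p k * p (t - k) / p t, where
  k = b - a. In 2r steps the walk reaches every vertex with probability at least a constant multiple
  of 1/N, so by Doeblin's argument p k = 1/N up to an error O(\<gamma>^k / d) with a constant \<gamma> < 1. Once
  t is well above log n, the expected number of collisions is therefore O(t^2/N + t/d). For shorter
  cycles, log-convexity of k \<mapsto> p (2k) (Cauchy-Schwarz) and p (k + 1) \<ge> c * p k (every edge lies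
  in at least cd triangles) bound each collision probability by O(1/d), and d grows at least
  linearly in n.

  Conversely, let t be at least a constant multiple of the minimum. Half of an injective homomorphism
  is a self-avoiding walk, and the other half contributes a factor close to d^(t - L) / N. A
  self-avoiding walk never returns to the vertex visited two steps earlier, which costs a factor
  1 - 1/d in each step; in every 2r steps it also has to avoid the vertices visited so far, which
  costs a factor 1 - const * L/N.
\<close>

section \<open>Counting walks\<close>

text \<open>For vertices in \<open>V\<close> this is the entry at \<open>(x, y)\<close> of the
  \<open>k\<close>-th power of the adjacency matrix.\<close>

primrec nwalks :: "'a set \<Rightarrow> ('a \<Rightarrow> 'a \<Rightarrow> bool) \<Rightarrow> nat \<Rightarrow> 'a \<Rightarrow> 'a \<Rightarrow> nat" where
  "nwalks V E 0 x y = of_bool (x = y)"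
| "nwalks V E (Suc k) x y = (\<Sum>z\<in>{z\<in>V. E x z}. nwalks V E k z y)"

definition walks :: "'a set \<Rightarrow> ('a \<Rightarrow> 'a \<Rightarrow> bool) \<Rightarrow> nat \<Rightarrow> 'a \<Rightarrow> 'a \<Rightarrow> 'a list set" where
  "walks V E k x y =
     {xs. length xs = Suc k \<and> set xs \<subseteq> V \<and> successively E xs \<and> hd xs = x \<and> last xs = y}"

definition self_avoiding :: "'a set \<Rightarrow> ('a \<Rightarrow> 'a \<Rightarrow> bool) \<Rightarrow> nat \<Rightarrow> 'a list set" where
  "self_avoiding V E k = {xs. length xs = Suc k \<and> set xs \<subseteq> V \<and> successively E xs \<and> distinct xs}"

lemma finite_walks:
  assumes "finite V" shows "finite (walks V E k x y)"
  by (rule finite_subset[OF _ finite_lists_length_eq[OF assms, of "Suc k"]]) (auto simp: walks_def)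

lemma finite_self_avoiding:
  assumes "finite V" shows "finite (self_avoiding V E k)"
  by (rule finite_subset[OF _ finite_lists_length_eq[OF assms, of "Suc k"]])
     (auto simp: self_avoiding_def)

lemma walks_Suc:
  assumes "x \<in> V"
  shows "walks V E (Suc k) x y = (#) x ` (\<Union>z\<in>{z\<in>V. E x z}. walks V E k z y)"
proof (intro equalityI subsetI)
  fix xs assume xs: "xs \<in> walks V E (Suc k) x y"
  then obtain ys where ys: "xs = x # ys" "length ys = Suc k"
    by (cases xs) (auto simp: walks_def)
  then obtain z zs where "ys = z # zs" by (cases ys) auto
  with xs ys show "xs \<in> (#) x ` (\<Union>z\<in>{z\<in>V. E x z}. walks V E k z y)"
    by (auto simp: walks_def)
next
  fix xs assume "xs \<in> (#) x ` (\<Union>z\<in>{z\<in>V. E x z}. walks V E k z y)"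
  with assms show "xs \<in> walks V E (Suc k) x y"
    by (auto simp: walks_def successively_Cons)
qed

text \<open>Grouping walks by their second vertex gives the recursion of \<open>nwalks\<close>.
  Algebra is done with the recursion, injections with lists; this lemma translates between
  them.\<close>

lemma card_walks:
  assumes "finite V" "x \<in> V"
  shows "card (walks V E k x y) = nwalks V E k x y"
  using assms(2)
proof (induction k arbitrary: x)
  case 0
  have "walks V E 0 x y = (if x = y then {[x]} else {})"
    using 0 by (auto simp: walks_def length_Suc_conv)
  then show ?case by simp
next
  case (Suc k)
  have "card (walks V E (Suc k) x y) = card (\<Union>z\<in>{z\<in>V. E x z}. walks V E k z y)"
    unfolding walks_Suc[OF Suc.prems] by (intro card_image) simp
  also have "\<dots> = (\<Sum>z\<in>{z\<in>V. E x z}. card (walks V E k z y))"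
    using assms(1) by (intro card_UN_disjoint) (auto simp: finite_walks, auto simp: walks_def)
  finally show ?case using Suc.IH by simp
qed

text \<open>Split at the vertex reached after \<open>k\<close> steps: a product of two matrix
  powers.\<close>

lemma nwalks_add:
  assumes "finite V" "x \<in> V"
  shows "nwalks V E (k + l) x y = (\<Sum>z\<in>V. nwalks V E k x z * nwalks V E l z y)"
  using assms(2)
proof (induction k arbitrary: x)
  case 0
  then show ?case using assms(1) by simp
next
  case (Suc k)
  have "nwalks V E (Suc k + l) x y
      = (\<Sum>w\<in>{w\<in>V. E x w}. \<Sum>z\<in>V. nwalks V E k w z * nwalks V E l z y)"
    using Suc.IH by simp
  also have "\<dots> = (\<Sum>z\<in>V. \<Sum>w\<in>{w\<in>V. E x w}. nwalks V E k w z * nwalks V E l z y)"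
    by (rule sum.swap)
  finally show ?case by (simp add: sum_distrib_right)
qed

text \<open>An automorphism maps the neighbours of \<open>x\<close> bijectively onto those of
  \<open>\<sigma> x\<close>, so each sum in the recursion can be reindexed along it.\<close>

lemma nwalks_automorphism:
  assumes \<sigma>: "bij_betw \<sigma> V V" and adj: "\<And>x y. x \<in> V \<Longrightarrow> y \<in> V \<Longrightarrow> E (\<sigma> x) (\<sigma> y) = E x y"
    and "x \<in> V" "y \<in> V"
  shows "nwalks V E k (\<sigma> x) (\<sigma> y) = nwalks V E k x y"
  using assms(3)
proof (induction k arbitrary: x)
  case 0
  then show ?case
    using inj_on_eq_iff[OF bij_betw_imp_inj_on[OF \<sigma>] _ assms(4)] by simp
next
  case (Suc k)
  have "bij_betw \<sigma> {z\<in>V. E x z} {z\<in>V. E (\<sigma> x) z}"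
    unfolding bij_betw_def
  proof
    show "inj_on \<sigma> {z\<in>V. E x z}"
      using \<sigma> by (auto simp: bij_betw_def intro: inj_on_subset)
    show "\<sigma> ` {z\<in>V. E x z} = {z\<in>V. E (\<sigma> x) z}"
    proof (intro equalityI subsetI)
      fix w assume w: "w \<in> {z\<in>V. E (\<sigma> x) z}"
      then obtain z where "z \<in> V" "w = \<sigma> z"
        using bij_betw_imp_surj_on[OF \<sigma>] by blast
      with w adj[OF Suc.prems] show "w \<in> \<sigma> ` {z\<in>V. E x z}" by auto
    qed (use bij_betwE[OF \<sigma>] adj[OF Suc.prems] in auto)
  qed
  from sum.reindex_bij_betw[OF this, of "\<lambda>z. nwalks V E k z (\<sigma> y)"]
  have "nwalks V E (Suc k) (\<sigma> x) (\<sigma> y) = (\<Sum>z\<in>{z\<in>V. E x z}. nwalks V E k (\<sigma> z) (\<sigma> y))"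
    by simp
  then show ?case using Suc.IH by simp
qed

section \<open>Cutting cycle homomorphisms into walks\<close>

definition segment :: "(nat \<Rightarrow> 'a) \<Rightarrow> nat \<Rightarrow> nat \<Rightarrow> 'a list" where
  "segment \<psi> i j = map \<psi> [i..<Suc j]"

text \<open>Since \<open>segment\<close> contains both ends, it has \<open>j - i\<close> edges, and
  consecutive segments share a vertex. A cycle can thus be cut into walks with matching
  ends.\<close>

lemma segment_walk:
  assumes "i \<le> j" "\<And>l. i \<le> l \<Longrightarrow> l \<le> j \<Longrightarrow> \<psi> l \<in> V"
    "\<And>l. i \<le> l \<Longrightarrow> l < j \<Longrightarrow> E (\<psi> l) (\<psi> (Suc l))"
  shows "segment \<psi> i j \<in> walks V E (j - i) (\<psi> i) (\<psi> j)"
  using assms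
  by (auto simp: segment_def walks_def successively_conv_nth hd_map last_map simp del: upt_Suc)

lemma segment_eqD:
  assumes "segment \<psi> i j = segment \<psi>' i j" "i \<le> l" "l \<le> j"
  shows "\<psi> l = \<psi>' l"
  using assms by (auto simp: segment_def simp del: upt_Suc)

text \<open>The homomorphism \<phi> of the cycle is read as the closed walk \<^term>\<open>\<lambda>i. \<phi> (i mod t)\<close> of
  length t.\<close>

lemma cycle_hom_step:
  assumes "\<phi> \<in> homs (cycle_verts t) (cycle_adj t) V E" "0 < t"
  shows "\<phi> (l mod t) \<in> V" "l < t \<Longrightarrow> E (\<phi> (l mod t)) (\<phi> (Suc l mod t))"
proof -
  have V: "\<phi> i \<in> V" if "i < t" for i
    using assms that by (auto simp: homs_def cycle_verts_def)
  show "\<phi> (l mod t) \<in> V"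
    using assms by (intro V) simp
  have "E (\<phi> u) (\<phi> v)" if "cycle_adj t u v" for u v
  proof -
    have "u < t" "v < t" using that by (auto simp: cycle_adj_def)
    with assms(1) that show ?thesis by (simp add: homs_def cycle_verts_def)
  qed
  from this[of "l mod t" "Suc l mod t"] show "E (\<phi> (l mod t)) (\<phi> (Suc l mod t))" if "l < t"
    using assms(2) that by (simp add: cycle_adj_def)
qed

lemma cycle_hom_eqI:
  assumes "\<phi> \<in> homs (cycle_verts t) (cycle_adj t) V E" "\<phi>' \<in> homs (cycle_verts t) (cycle_adj t) V E"
    "\<And>l. l < t \<Longrightarrow> \<phi> (l mod t) = \<phi>' (l mod t)"
  shows "\<phi> = \<phi>'"
  using assms by (intro PiE_ext[of _ "{0..<t}" "\<lambda>_. V"]) (auto simp: homs_def cycle_verts_def)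

lemma finite_homs_cycle:
  assumes "finite V" shows "finite (homs (cycle_verts t) EH V E)"
  by (rule finite_subset[OF _ finite_PiE[of "{0..<t}" "\<lambda>_. V"]])
     (use assms in \<open>auto simp: homs_def cycle_verts_def\<close>)

text \<open>A closed walk is a list whose last entry repeats the first; forgetting the last entry
  gives a homomorphism. Symmetry enters because \<open>cycle_adj\<close> contains both orientations
  of every edge.\<close>

lemma hom_count_cycle_ge:
  assumes V: "finite V" and sym: "\<And>x y. E x y \<Longrightarrow> E y x" and t: "0 < t"
  shows "(\<Sum>x\<in>V. nwalks V E t x x) \<le> hom_count (cycle_verts t) (cycle_adj t) V E"
proof -
  define f where "f xs = restrict ((!) xs) {0..<t}" for xs :: "'a list"
  have closed: "xs ! t = xs ! 0" if "xs \<in> walks V E t x x" for xs x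
  proof -
    from that have "xs \<noteq> []" "length xs = Suc t" "last xs = hd xs" by (auto simp: walks_def)
    then show ?thesis by (simp add: hd_conv_nth last_conv_nth)
  qed
  have inj: "inj_on f (\<Union>x\<in>V. walks V E t x x)"
  proof (rule inj_onI)
    fix xs ys assume xs: "xs \<in> (\<Union>x\<in>V. walks V E t x x)" and ys: "ys \<in> (\<Union>x\<in>V. walks V E t x x)"
      and eq: "f xs = f ys"
    have nth: "xs ! i = ys ! i" if "i < t" for i
      using fun_cong[OF eq, of i] that by (simp add: f_def)
    have "xs ! t = xs ! 0" "ys ! t = ys ! 0"
      using xs ys closed by blast+
    with nth t have "xs ! i = ys ! i" if "i < Suc t" for i
      using that by (cases "i = t") auto
    then show "xs = ys"
      using xs ys by (intro nth_equalityI) (auto simp: walks_def)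
  qed
  have img: "f ` (\<Union>x\<in>V. walks V E t x x) \<subseteq> homs (cycle_verts t) (cycle_adj t) V E"
  proof (rule image_subsetI)
    fix xs assume "xs \<in> (\<Union>x\<in>V. walks V E t x x)"
    then have len: "length xs = Suc t" and sub: "set xs \<subseteq> V" and succ: "successively E xs"
      and closed: "xs ! t = xs ! 0"
      using closed by (auto simp: walks_def)
    have in_V: "xs ! i \<in> V" if "i < t" for i
      using that len sub by (auto intro!: subsetD[OF sub] nth_mem)
    have step: "E (xs ! i) (xs ! (Suc i mod t))" if "i < t" for i
    proof -
      have "E (xs ! i) (xs ! Suc i)"
        using succ len that by (auto simp: successively_conv_nth)
      \<comment> \<open>Only \<open>i = t - 1\<close> wraps around, and there closedness of the walk
        supplies the edge back to entry 0.\<close>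
      moreover have "xs ! (Suc i mod t) = xs ! Suc i"
        using that closed by (cases "Suc i = t") auto
      ultimately show ?thesis by simp
    qed
    show "f xs \<in> homs (cycle_verts t) (cycle_adj t) V E"
      using in_V step t
      by (auto simp: f_def homs_def cycle_verts_def cycle_adj_def intro: sym)
  qed
  have "(\<Sum>x\<in>V. nwalks V E t x x) = (\<Sum>x\<in>V. card (walks V E t x x))"
    using V by (simp add: card_walks)
  also have "\<dots> = card (\<Union>x\<in>V. walks V E t x x)"
    using V by (intro card_UN_disjoint[symmetric]) (auto simp: finite_walks, auto simp: walks_def)
  also have "\<dots> \<le> card (homs (cycle_verts t) (cycle_adj t) V E)"
    using inj img finite_homs_cycle[OF V] by (intro card_inj_on_le)
  finally show ?thesis by (simp add: hom_count_def)
qed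

text \<open>Cut the cycle at 0, \<open>a\<close> and \<open>b\<close>. With \<open>x\<close> the
  image of 0 and \<open>z\<close> the common image of \<open>a\<close> and \<open>b\<close>, the
  pieces are a walk from \<open>x\<close> to \<open>z\<close>, a closed walk at \<open>z\<close>,
  and a walk from \<open>z\<close> back to \<open>x\<close>.\<close>

lemma card_cycle_homs_collision_le:
  assumes V: "finite V" and "a < b" "b < t"
  shows "card {\<phi> \<in> homs (cycle_verts t) (cycle_adj t) V E. \<phi> a = \<phi> b}
    \<le> (\<Sum>x\<in>V. \<Sum>z\<in>V. nwalks V E a x z * nwalks V E (b - a) z z * nwalks V E (t - b) z x)"
proof -
  let ?H = "{\<phi> \<in> homs (cycle_verts t) (cycle_adj t) V E. \<phi> a = \<phi> b}"
  define cyc where "cyc \<phi> i = \<phi> (i mod t)" for \<phi> :: "nat \<Rightarrow> 'a" and i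
  define f where "f \<phi> = ((\<phi> 0, \<phi> a), segment (cyc \<phi>) 0 a, segment (cyc \<phi>) a b, segment (cyc \<phi>) b t)"
    for \<phi> :: "nat \<Rightarrow> 'a"
  define T where "T = (SIGMA p:V \<times> V. walks V E a (fst p) (snd p)
      \<times> walks V E (b - a) (snd p) (snd p) \<times> walks V E (t - b) (snd p) (fst p))"
  have t: "0 < t" using assms by simp
  have "inj_on f ?H"
  proof (rule inj_onI)
    fix \<phi> \<phi>' assume H: "\<phi> \<in> ?H" "\<phi>' \<in> ?H" and eq: "f \<phi> = f \<phi>'"
    have "cyc \<phi> l = cyc \<phi>' l" if "l < t" for l
    \<comment> \<open>Every position lies in one of the three segments, so equal segments force
      equal values.\<close>
    proof (cases "l \<le> a"; cases "l \<le> b")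
    qed (use that eq segment_eqD[of "cyc \<phi>" _ _ "cyc \<phi>'" l] in \<open>auto simp: f_def\<close>)
    then show "\<phi> = \<phi>'"
      using H by (intro cycle_hom_eqI[of _ t V E]) (auto simp: cyc_def)
  qed
  moreover have "f ` ?H \<subseteq> T"
  proof (rule image_subsetI)
    fix \<phi> assume \<phi>: "\<phi> \<in> ?H"
    have seg: "segment (cyc \<phi>) i j \<in> walks V E (j - i) (cyc \<phi> i) (cyc \<phi> j)" if "i \<le> j" "j \<le> t" for i j
      using that \<phi> cycle_hom_step[of \<phi> t V E] t by (intro segment_walk) (auto simp: cyc_def)
    have ends: "cyc \<phi> 0 = \<phi> 0" "cyc \<phi> a = \<phi> a" "cyc \<phi> b = \<phi> a" "cyc \<phi> t = \<phi> 0"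
      using assms \<phi> by (auto simp: cyc_def)
    have "\<phi> 0 \<in> V" "\<phi> a \<in> V"
      using cycle_hom_step(1)[of \<phi> t V E 0] cycle_hom_step(1)[of \<phi> t V E a] \<phi> assms by auto
    then show "f \<phi> \<in> T"
      using seg[of 0 a] seg[of a b] seg[of b t] assms by (auto simp: f_def T_def ends)
  qed
  moreover have "finite T"
    unfolding T_def using V by (auto simp: finite_walks)
  ultimately have "card ?H \<le> card T"
    by (rule card_inj_on_le)
  also have "card T = (\<Sum>p\<in>V \<times> V. nwalks V E a (fst p) (snd p)
      * (nwalks V E (b - a) (snd p) (snd p) * nwalks V E (t - b) (snd p) (fst p)))"
    unfolding T_def using V
    by (subst card_SigmaI) (auto simp: finite_walks card_cartesian_product card_walks intro!: sum.cong)
  also have "\<dots> = (\<Sum>x\<in>V. \<Sum>z\<in>V. nwalks V E a x z * nwalks V E (b - a) z z * nwalks V E (t - b) z x)"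
    by (simp add: sum.cartesian_product mult.assoc case_prod_beta)
  finally show ?thesis .
qed

text \<open>Injectivity is kept on the first \<open>L\<close> edges only, where it gives a
  self-avoiding walk. The rest is relaxed to an arbitrary walk back to the start, for which there
  are at most \<open>K\<close> choices.\<close>

lemma mon_count_cycle_le:
  fixes K :: real
  assumes V: "finite V" and L: "L < t"
    and K: "\<And>x y. x \<in> V \<Longrightarrow> y \<in> V \<Longrightarrow> real (nwalks V E (t - L) x y) \<le> K"
  shows "real (mon_count (cycle_verts t) (cycle_adj t) V E) \<le> real (card (self_avoiding V E L)) * K"
proof -
  let ?H = "{\<phi> \<in> homs (cycle_verts t) (cycle_adj t) V E. inj_on \<phi> (cycle_verts t)}"
  define cyc where "cyc \<phi> i = \<phi> (i mod t)" for \<phi> :: "nat \<Rightarrow> 'a" and i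
  define f where "f \<phi> = (segment (cyc \<phi>) 0 L, segment (cyc \<phi>) L t)" for \<phi> :: "nat \<Rightarrow> 'a"
  define T where "T = (SIGMA xs:self_avoiding V E L. walks V E (t - L) (last xs) (hd xs))"
  have t: "0 < t" using assms by simp
  have "inj_on f ?H"
  proof (rule inj_onI)
    fix \<phi> \<phi>' assume H: "\<phi> \<in> ?H" "\<phi>' \<in> ?H" and eq: "f \<phi> = f \<phi>'"
    have "cyc \<phi> l = cyc \<phi>' l" if "l < t" for l
    proof (cases "l \<le> L")
    qed (use that eq segment_eqD[of "cyc \<phi>" _ _ "cyc \<phi>'" l] in \<open>auto simp: f_def\<close>)
    then show "\<phi> = \<phi>'"
      using H by (intro cycle_hom_eqI[of _ t V E]) (auto simp: cyc_def)
  qed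
  moreover have "f ` ?H \<subseteq> T"
  proof (rule image_subsetI)
    fix \<phi> assume \<phi>: "\<phi> \<in> ?H"
    have seg: "segment (cyc \<phi>) i j \<in> walks V E (j - i) (cyc \<phi> i) (cyc \<phi> j)" if "i \<le> j" "j \<le> t" for i j
      using that \<phi> cycle_hom_step[of \<phi> t V E] t by (intro segment_walk) (auto simp: cyc_def)
    \<comment> \<open>\<open>L < t\<close> keeps position \<open>t\<close>, which wraps around to 0,
      out of the range.\<close>
    have "inj_on (cyc \<phi>) {0..L}"
      using \<phi> L by (auto simp: cyc_def inj_on_def cycle_verts_def)
    then have "distinct (segment (cyc \<phi>) 0 L)"
      by (simp add: segment_def distinct_map atLeastLessThanSuc_atLeastAtMost del: upt_Suc)
    moreover have "cyc \<phi> t = cyc \<phi> 0" by (simp add: cyc_def)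
    ultimately show "f \<phi> \<in> T"
      using seg[of 0 L] seg[of L t] L by (auto simp: f_def T_def self_avoiding_def walks_def)
  qed
  moreover have "finite T"
    unfolding T_def using V by (auto simp: finite_walks finite_self_avoiding)
  ultimately have "card ?H \<le> card T"
    by (rule card_inj_on_le)
  also have "card T = (\<Sum>xs\<in>self_avoiding V E L. card (walks V E (t - L) (last xs) (hd xs)))"
    unfolding T_def using V by (subst card_SigmaI) (auto simp: finite_walks finite_self_avoiding)
  finally have "real (card ?H)
      \<le> (\<Sum>xs\<in>self_avoiding V E L. real (card (walks V E (t - L) (last xs) (hd xs))))"
    by (simp flip: of_nat_sum)
  also have "\<dots> \<le> (\<Sum>xs\<in>self_avoiding V E L. K)"
  proof (rule sum_mono)
    fix xs assume xs: "xs \<in> self_avoiding V E L"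
    then have "xs \<noteq> []" by (auto simp: self_avoiding_def)
    with xs have "last xs \<in> V" "hd xs \<in> V"
      using last_in_set[of xs] hd_in_set[of xs] by (auto simp: self_avoiding_def)
    then show "real (card (walks V E (t - L) (last xs) (hd xs))) \<le> K"
      using K V by (simp add: card_walks)
  qed
  finally show ?thesis by (simp add: mon_count_def)
qed

section \<open>Mixing graphs\<close>

text \<open>\<open>homogeneous\<close> is the consequence of vertex transitivity that the argument
  uses. \<open>minorization\<close> is Doeblin's condition: \<open>m\<close> random steps reach
  every vertex with probability at least \<open>\<alpha>\<close> times the uniform one.
  \<open>codegree\<close> says that every edge lies in at least \<open>c * d\<close> triangles, as
  walks of length 2 count common neighbours.\<close>

locale mixing_graph =
  fixes V :: "'a set" and E :: "'a \<Rightarrow> 'a \<Rightarrow> bool" and d m :: nat and \<alpha> c :: real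
  assumes finite_V: "finite V" and V_nonempty: "V \<noteq> {}"
    and adj_sym: "E x y \<Longrightarrow> E y x"
    and adj_irrefl: "x \<in> V \<Longrightarrow> \<not> E x x"
    and degree: "x \<in> V \<Longrightarrow> card {y\<in>V. E x y} = d" and d_pos: "0 < d"
    and m_pos: "0 < m" and \<alpha>: "0 < \<alpha>" "\<alpha> < 1" and c: "0 < c" "c \<le> 1"
    and homogeneous: "x \<in> V \<Longrightarrow> y \<in> V \<Longrightarrow> nwalks V E k x x = nwalks V E k y y"
    and minorization: "x \<in> V \<Longrightarrow> y \<in> V \<Longrightarrow> \<alpha> / card V * real d ^ m \<le> nwalks V E m x y"
    and codegree: "x \<in> V \<Longrightarrow> y \<in> V \<Longrightarrow> E x y \<Longrightarrow> c * d \<le> nwalks V E 2 x y"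
begin

section \<open>Transition and return probabilities of the simple random walk\<close>

definition P :: "nat \<Rightarrow> 'a \<Rightarrow> 'a \<Rightarrow> real" where
  "P k x y = real (nwalks V E k x y) / real d ^ k"

definition N :: real where "N = real (card V)"

text \<open>By \<open>homogeneous\<close> the chosen base vertex does not matter; see
  \<open>P_diag\<close>.\<close>

definition p :: "nat \<Rightarrow> real" where "p k = P k (SOME x. x \<in> V) (SOME x. x \<in> V)"

lemma N_pos: "0 < N"
  using finite_V V_nonempty by (simp add: N_def card_gt_0_iff)

lemma P_nonneg: "0 \<le> P k x y"
  by (simp add: P_def)

lemma P_diag: "x \<in> V \<Longrightarrow> P k x x = p k"
  using homogeneous[of x "SOME x. x \<in> V"] V_nonempty some_in_eq[of V] by (simp add: P_def p_def)

lemma p_nonneg: "0 \<le> p k"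
  by (simp add: p_def P_nonneg)

lemma nwalks_eq: "real (nwalks V E k x y) = P k x y * real d ^ k"
  using d_pos by (simp add: P_def)

lemma P_0: "P 0 x y = of_bool (x = y)"
  by (simp add: P_def)

lemma P_Suc: "P (Suc k) x y = (\<Sum>z\<in>V. of_bool (E x z) / d * P k z y)"
proof -
  have "P (Suc k) x y = (\<Sum>z\<in>{z\<in>V. E x z}. P k z y / d)"
    by (simp add: P_def sum_divide_distrib mult.commute)
  also have "\<dots> = (\<Sum>z\<in>V. of_bool (E x z) / d * P k z y)"
    using finite_V by (simp add: sum.inter_filter of_bool_def) (intro sum.cong, auto)
  finally show ?thesis .
qed

lemma P_1: "y \<in> V \<Longrightarrow> P 1 x y = of_bool (E x y) / d"
  using finite_V by (simp add: P_Suc P_0 sum.delta' of_bool_def[of "_ = y"] if_distrib[of "(*) _"] cong: if_cong)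

lemma P_add:
  assumes "x \<in> V" shows "P (k + l) x y = (\<Sum>z\<in>V. P k x z * P l z y)"
  using nwalks_add[OF finite_V assms, of E k l y]
  by (simp add: P_def power_add sum_divide_distrib)

text \<open>Reversal of walks: the first step of one walk becomes the last step of the
  other.\<close>

lemma P_sym:
  assumes "x \<in> V" "y \<in> V" shows "P k x y = P k y x"
  using assms
proof (induction k arbitrary: x y)
  case 0
  then show ?case by (simp add: P_0 eq_commute)
next
  case (Suc k)
  have "P (Suc k) x y = (\<Sum>z\<in>V. P k y z * P 1 z x)"
    unfolding P_Suc
  proof (intro sum.cong refl)
    fix z assume "z \<in> V"
    moreover have "E x z \<longleftrightarrow> E z x" using adj_sym by blast
    ultimately show "of_bool (E x z) / real d * P k z y = P k y z * P 1 z x"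
      using Suc by (simp add: P_1[simplified])
  qed
  also have "\<dots> = P (k + 1) y x"
    using Suc.prems by (intro P_add[symmetric])
  finally show ?case by simp
qed

lemma P_row: "x \<in> V \<Longrightarrow> (\<Sum>y\<in>V. P k x y) = 1"
proof (induction k arbitrary: x)
  case 0
  then show ?case using finite_V by (simp add: P_0)
next
  case (Suc k)
  have "(\<Sum>y\<in>V. P (Suc k) x y) = (\<Sum>z\<in>V. of_bool (E x z) / d * (\<Sum>y\<in>V. P k z y))"
    unfolding P_Suc sum_distrib_left by (rule sum.swap)
  also have "\<dots> = real (card {z\<in>V. E x z}) / d"
    using Suc.IH finite_V by (simp add: sum_divide_distrib[symmetric] Int_def conj_commute)
  finally show ?case using degree[OF Suc.prems] d_pos by simp
qed

lemma P_col: "y \<in> V \<Longrightarrow> (\<Sum>x\<in>V. P k x y) = 1"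
  using P_row[of y k] P_sym[of y _ k] by simp

text \<open>The first step hits any given vertex with probability at most \<open>1 / d\<close>; what
  remains is a column sum, which is 1.\<close>

lemma P_le: "x \<in> V \<Longrightarrow> y \<in> V \<Longrightarrow> 0 < k \<Longrightarrow> P k x y \<le> 1 / d"
proof -
  assume xy: "x \<in> V" "y \<in> V" and "0 < k"
  then obtain l where k: "k = Suc l" by (cases k) auto
  have "P k x y = (\<Sum>z\<in>V. P 1 x z * P l z y)"
    using P_add[OF xy(1), of 1 l y] k by simp
  also have "\<dots> \<le> (\<Sum>z\<in>V. 1 / d * P l z y)"
    by (intro sum_mono mult_right_mono) (auto simp: P_1[simplified] P_nonneg)
  also have "\<dots> = 1 / d"
    using P_col[OF xy(2)] by (simp add: sum_divide_distrib[symmetric])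
  finally show ?thesis .
qed

lemma minor: "x \<in> V \<Longrightarrow> y \<in> V \<Longrightarrow> \<alpha> / N \<le> P m x y"
  using minorization[of x y] d_pos by (simp add: P_def N_def pos_le_divide_eq)

definition \<gamma> :: real where "\<gamma> = root m (1 - \<alpha>)"

text \<open>The root turns a contraction by \<open>1 - \<alpha>\<close> per \<open>m\<close> steps
  into a rate per single step.\<close>

lemma \<gamma>: "0 < \<gamma>" "\<gamma> < 1" "\<gamma> ^ m = 1 - \<alpha>"
  using m_pos \<alpha> by (auto simp: \<gamma>_def)

text \<open>Doeblin's argument: the part \<alpha>/N of every entry of the m-step matrix is distributed
  uniformly, so m more steps shrink the distance to the uniform distribution by 1 - \<alpha>.\<close>

lemma P_upper_step:
  assumes "\<And>x. x \<in> V \<Longrightarrow> P k x y \<le> 1 / N + B" and xy: "x \<in> V" "y \<in> V"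
  shows "P (k + m) x y \<le> 1 / N + (1 - \<alpha>) * B"
proof -
  have "P (k + m) x y = (\<Sum>z\<in>V. (P m x z - \<alpha> / N) * P k z y) + \<alpha> / N * (\<Sum>z\<in>V. P k z y)"
    using P_add[OF xy(1), of m k y]
    by (simp add: add.commute left_diff_distrib sum_subtractf sum_distrib_left)
  also have "(\<Sum>z\<in>V. (P m x z - \<alpha> / N) * P k z y) \<le> (\<Sum>z\<in>V. (P m x z - \<alpha> / N) * (1 / N + B))"
    using assms(1) minor[OF xy(1)] by (intro sum_mono mult_left_mono) auto
  also have "\<dots> = (1 - \<alpha>) * (1 / N + B)"
    using P_row[OF xy(1)] N_pos
    by (simp add: sum_distrib_right[symmetric] sum_subtractf N_def[symmetric])
  finally show ?thesis
    using P_col[OF xy(2)] by (simp add: algebra_simps diff_divide_distrib)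
qed

lemma P_lower_step:
  assumes "\<And>x. x \<in> V \<Longrightarrow> 1 / N - B \<le> P k x y" and xy: "x \<in> V" "y \<in> V"
  shows "1 / N - (1 - \<alpha>) * B \<le> P (k + m) x y"
proof -
  have "(1 - \<alpha>) * (1 / N - B) = (\<Sum>z\<in>V. (P m x z - \<alpha> / N) * (1 / N - B))"
    using P_row[OF xy(1)] N_pos
    by (simp add: sum_distrib_right[symmetric] sum_subtractf N_def[symmetric])
  also have "\<dots> \<le> (\<Sum>z\<in>V. (P m x z - \<alpha> / N) * P k z y)"
    using assms(1) minor[OF xy(1)] by (intro sum_mono mult_left_mono) auto
  also have "\<dots> = P (k + m) x y - \<alpha> / N * (\<Sum>z\<in>V. P k z y)"
    using P_add[OF xy(1), of m k y]
    by (simp add: add.commute left_diff_distrib sum_subtractf sum_distrib_left)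
  finally show ?thesis
    using P_col[OF xy(2)] by (simp add: algebra_simps diff_divide_distrib)
qed

text \<open>The iteration starts from \<open>P_le\<close>, hence \<open>0 < k\<close> and an initial
  error of \<open>1 / d\<close>. Keeping this \<open>1 / d\<close> is what makes the total error
  over all \<open>k\<close> of order \<open>1 / d\<close>.\<close>

lemma P_upper_iter:
  assumes "x \<in> V" "y \<in> V" "0 < k"
  shows "P (k + q * m) x y \<le> 1 / N + (1 - \<alpha>) ^ q / d"
  using assms(1)
proof (induction q arbitrary: x)
  case 0
  then show ?case
    using P_le[OF 0 assms(2,3)] N_pos by simp (smt (verit) divide_pos_pos)
next
  case (Suc q)
  have "P (k + q * m + m) x y \<le> 1 / N + (1 - \<alpha>) * ((1 - \<alpha>) ^ q / d)"
    using Suc assms(2) by (intro P_upper_step) auto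
  then show ?case by (simp add: algebra_simps)
qed

text \<open>Here the iteration starts from nonnegativity, so the initial error is
  \<open>1 / N\<close>.\<close>

lemma P_lower_iter:
  assumes "x \<in> V" "y \<in> V"
  shows "1 / N - (1 - \<alpha>) ^ q / N \<le> P (k + q * m) x y"
  using assms(1)
proof (induction q arbitrary: x)
  case 0
  then show ?case by (simp add: P_nonneg)
next
  case (Suc q)
  have "1 / N - (1 - \<alpha>) * ((1 - \<alpha>) ^ q / N) \<le> P (k + q * m + m) x y"
    using Suc assms(2) by (intro P_lower_step) auto
  then show ?case by (simp add: algebra_simps)
qed

text \<open>An incomplete block of \<open>m\<close> steps costs at most one factor
  \<open>1 - \<alpha>\<close>. The exponent may even be \<open>Suc k\<close>, since
  \<open>Suc k\<close> is at most \<open>Suc (k div m) * m\<close>.\<close>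

lemma \<gamma>_power_div_le: "(1 - \<alpha>) ^ (k div m) \<le> \<gamma> ^ (Suc k) / (1 - \<alpha>)"
proof -
  have "Suc k \<le> Suc (k div m) * m"
    using m_pos by (simp add: dividend_less_div_times Suc_le_eq add.commute)
  then have "\<gamma> ^ (Suc (k div m) * m) \<le> \<gamma> ^ Suc k"
    using \<gamma> by (intro power_decreasing) auto
  then show ?thesis
    using \<alpha> by (simp only: mult.commute[of _ m] power_mult \<gamma>(3)) (simp add: field_simps)
qed

lemma P_upper:
  assumes "x \<in> V" "y \<in> V" "0 < k"
  shows "P k x y \<le> 1 / N + \<gamma> ^ k / ((1 - \<alpha>) * d)"
proof -
  obtain l where l: "k = Suc l" using assms(3) by (cases k) auto
  \<comment> \<open>One step is set aside so that the remainder \<open>Suc (l mod m)\<close> is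
    positive, as \<open>P_upper_iter\<close> demands.\<close>
  have k: "k = Suc (l mod m) + (l div m) * m" using l by simp
  have "P k x y \<le> 1 / N + (1 - \<alpha>) ^ (l div m) / d"
    using P_upper_iter[OF assms(1,2), of "Suc (l mod m)" "l div m"] k by simp
  also have "(1 - \<alpha>) ^ (l div m) / d \<le> \<gamma> ^ k / (1 - \<alpha>) / d"
    using \<gamma>_power_div_le[of l] l by (intro divide_right_mono) auto
  finally show ?thesis by simp
qed

lemma P_lower:
  assumes "x \<in> V" "y \<in> V"
  shows "(1 - \<gamma> ^ k / (1 - \<alpha>)) / N \<le> P k x y"
proof -
  have "(1 - \<alpha>) ^ (k div m) \<le> \<gamma> ^ k / (1 - \<alpha>)"
  proof (rule order_trans[OF \<gamma>_power_div_le[of k]])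
    show "\<gamma> ^ Suc k / (1 - \<alpha>) \<le> \<gamma> ^ k / (1 - \<alpha>)"
      using \<gamma> \<alpha> by (intro divide_right_mono power_decreasing) auto
  qed
  then have "(1 - \<gamma> ^ k / (1 - \<alpha>)) / N \<le> 1 / N - (1 - \<alpha>) ^ (k div m) / N"
    using divide_right_mono[of "(1 - \<alpha>) ^ (k div m)" "\<gamma> ^ k / (1 - \<alpha>)" N] N_pos
    by (simp add: diff_divide_distrib)
  then show ?thesis
    using P_lower_iter[OF assms, of "k div m" "k mod m"] by simp
qed

text \<open>Every edge lies in at least cd triangles, hence an edge of a walk can be replaced by a path
  of length two.\<close>

lemma P_edge_insertion:
  assumes "x \<in> V" "y \<in> V" "0 < k"
  shows "c * P k x y \<le> P (Suc k) x y"
proof -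
  \<comment> \<open>For \<open>z\<close> not adjacent to \<open>x\<close> the left side is 0;
    otherwise \<open>codegree\<close> applies.\<close>
  have two: "c * P 1 x z \<le> P 2 x z" if "z \<in> V" for z
    using codegree[OF assms(1) that] that P_1[OF that] P_nonneg[of 2 x z] d_pos
    by (auto simp: P_def power2_eq_square pos_le_divide_eq)
  obtain l where l: "k = 1 + l" using assms(3) by (cases k) auto
  have "c * P k x y = (\<Sum>z\<in>V. c * P 1 x z * P l z y)"
    using P_add[OF assms(1), of 1 l y] l by (simp add: sum_distrib_left mult.assoc)
  also have "\<dots> \<le> (\<Sum>z\<in>V. P 2 x z * P l z y)"
    using two by (intro sum_mono mult_right_mono) (auto simp: P_nonneg)
  also have "\<dots> = P (Suc k) x y"
    using P_add[OF assms(1), of 2 l y] l by simp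
  finally show ?thesis .
qed

section \<open>Return probabilities: edge insertion and log-convexity\<close>

lemma ex_V: "\<exists>x. x \<in> V" using V_nonempty by blast

lemma p_Suc_ge: "0 < k \<Longrightarrow> c * p k \<le> p (Suc k)"
  using P_edge_insertion ex_V P_diag by metis

lemma p_upper: "0 < k \<Longrightarrow> p k \<le> 1 / N + \<gamma> ^ k / ((1 - \<alpha>) * d)"
  using P_upper ex_V P_diag by metis

lemma p_lower: "(1 - \<gamma> ^ k / (1 - \<alpha>)) / N \<le> p k"
  using P_lower ex_V P_diag by metis

lemma p_1: "p 1 = 0"
  using ex_V P_diag P_1 adj_irrefl by (metis div_0 of_bool_eq(1))

lemma p_2: "p 2 = 1 / d"
proof -
  obtain x where x: "x \<in> V" using ex_V by blast
  have "p 2 = (\<Sum>z\<in>V. P 1 x z * P 1 z x)"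
    using P_add[OF x, of 1 1 x] P_diag[OF x, of 2] by (simp add: numeral_2_eq_2)
  also have "\<dots> = (\<Sum>z\<in>V. P 1 x z * (1 / d))"
    using x adj_sym by (intro sum.cong refl) (auto simp: P_1[simplified])
  also have "\<dots> = 1 / d"
    using P_row[OF x, of 1] by (simp add: sum_divide_distrib[symmetric])
  finally show ?thesis .
qed

text \<open>The range starts at 2 because \<open>p 1 = 0\<close>. From \<open>p 2 = 1 / d\<close>
  on, edge insertion reaches all longer lengths, odd ones included.\<close>

lemma p_pos: "2 \<le> k \<Longrightarrow> 0 < p k"
proof (induction k rule: dec_induct)
  case base
  then show ?case using p_2 d_pos by simp
next
  case (step k)
  then have "0 < c * p k" using c by simp
  also have "\<dots> \<le> p (Suc k)" using step by (intro p_Suc_ge) auto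
  finally show ?case .
qed

text \<open>By symmetry \<open>p (i + j)\<close> is the inner product of the rows
  \<open>P i x\<close> and \<open>P j x\<close>, so this is the Cauchy-Schwarz inequality.\<close>

lemma p_log_convex: "(p (k + l))\<^sup>2 \<le> p (2 * k) * p (2 * l)"
proof -
  obtain x where x: "x \<in> V" using ex_V by blast
  have sum: "p (i + j) = (\<Sum>z\<in>V. P i x z * P j x z)" for i j
  proof -
    have "p (i + j) = (\<Sum>z\<in>V. P i x z * P j z x)"
      using P_add[OF x, of i j x] P_diag[OF x] by simp
    also have "\<dots> = (\<Sum>z\<in>V. P i x z * P j x z)"
      using x by (intro sum.cong refl) (simp add: P_sym[of x])
    finally show ?thesis .
  qed
  show ?thesis
    using Cauchy_Schwarz_ineq_sum[of "P k x" "P l x" V] sum[of k l] sum[of k k] sum[of l l]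
    by (simp add: power2_eq_square mult_2)
qed

text \<open>For a log-convex sequence, moving two indices apart with fixed sum increases the
  product. The case \<open>k = l\<close> is log-convexity itself; the induction step applies it once
  more around \<open>l + 1\<close> and cancels the positive factor \<open>p (2 * l)\<close>.\<close>

lemma p_even_shift:
  assumes "1 \<le> k" "k \<le> l"
  shows "p (2 * k) * p (2 * l) \<le> p (2 * (k - 1)) * p (2 * (l + 1))"
  using assms(2)
proof (induction l rule: dec_induct)
  case base
  have "k - 1 + (k + 1) = 2 * k" using assms(1) by simp
  then show ?case
    using p_log_convex[of "k - 1" "k + 1"] by (simp only: power2_eq_square)
next
  case (step l)
  have pos: "0 < p (2 * l)" "0 < p (2 * (l + 1))" using step assms by (auto intro!: p_pos)
  have "p (2 * k) * p (2 * (l + 1)) * p (2 * l) \<le> p (2 * (k - 1)) * (p (2 * (l + 1)))\<^sup>2"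
    using mult_right_mono[OF step.IH, of "p (2 * (l + 1))"] pos
    by (simp add: power2_eq_square mult_ac)
  also have "\<dots> \<le> p (2 * (k - 1)) * (p (2 * l) * p (2 * (l + 2)))"
  proof (intro mult_left_mono p_nonneg)
    have "2 * (l + 1) = l + (l + 2)" by simp
    then show "(p (2 * (l + 1)))\<^sup>2 \<le> p (2 * l) * p (2 * (l + 2))"
      using p_log_convex[of l "l + 2"] by (simp only:)
  qed
  also have "\<dots> = p (2 * (k - 1)) * p (2 * (l + 2)) * p (2 * l)"
    by (simp only: mult_ac)
  finally have "p (2 * k) * p (2 * (l + 1)) \<le> p (2 * (k - 1)) * p (2 * (l + 2))"
    using pos(1) by (simp only: mult_le_cancel_right_pos)
  then show ?case by simp
qed

text \<open>Shift repeatedly until the smaller index is 1.\<close>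

lemma p_even_merge_le:
  assumes "1 \<le> k" "k \<le> l"
  shows "p (2 * k) * p (2 * l) \<le> p 2 * p (2 * (k + l - 1))"
  using assms
proof (induction k arbitrary: l rule: dec_induct)
  case base
  then show ?case by simp
next
  case (step k)
  have "p (2 * Suc k) * p (2 * l) \<le> p (2 * k) * p (2 * (l + 1))"
    using p_even_shift[of "Suc k" l] step by simp
  also have "\<dots> \<le> p 2 * p (2 * (k + (l + 1) - 1))"
    using step by (intro step.IH) auto
  finally show ?case by simp
qed

lemma p_add_ge:
  assumes "0 < k" shows "c ^ j * p k \<le> p (k + j)"
proof (induction j)
  case (Suc j)
  have "c ^ Suc j * p k \<le> c * p (k + j)"
    using Suc c by simp
  also have "\<dots> \<le> p (k + Suc j)"
    using p_Suc_ge[of "k + j"] assms by simp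
  finally show ?case .
qed simp

text \<open>Log-convexity only covers even lengths, so odd ones are rounded up by edge insertions,
  each costing a factor \<open>c\<close>. The gain \<open>1 / d\<close> is the value of
  \<open>p 2\<close>.\<close>

lemma p_merge_le:
  assumes "1 \<le> k" "k < t" "3 \<le> t"
  shows "p k * p (t - k) \<le> p t / (c ^ 4 * d)"
proof (cases "k = 1 \<or> k = t - 1")
  case True
  then have "p k * p (t - k) = 0" using p_1 assms by auto
  moreover have "0 \<le> p t / (c ^ 4 * d)" using p_nonneg[of t] c by simp
  ultimately show ?thesis by linarith
next
  case False
  \<comment> \<open>\<open>2 * a\<close> and \<open>2 * b\<close> are \<open>k\<close> and
    \<open>t - k\<close> rounded up to even numbers. Merging yields length
    \<open>2 * a + 2 * b - 2\<close>, which is at most \<open>t\<close>. Rounding takes at most one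
    insertion on each side, and returning to \<open>t\<close> takes at most two.\<close>
  define a where "a = (k + 1) div 2"
  define b where "b = (t - k + 1) div 2"
  have "k \<le> 2 * a" "2 * a \<le> k + 1" "t - k \<le> 2 * b" "2 * b \<le> t - k + 1"
    unfolding a_def b_def by linarith+
  moreover have "2 \<le> k" "2 \<le> t - k" using assms False by auto
  ultimately have ab: "1 \<le> a" "1 \<le> b" "k \<le> 2 * a" "t - k \<le> 2 * b" "2 * a + 2 * b - 2 \<le> t"
    "1 \<le> 2 * a + 2 * b - 2"
    and s: "(2 * a - k) + (2 * b - (t - k)) + (t - (2 * a + 2 * b - 2)) \<le> 4"
    using assms by linarith+
  have 1: "c ^ (2 * a - k) * p k \<le> p (2 * a)"
    using p_add_ge[of k "2 * a - k"] ab assms by simp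
  have 2: "c ^ (2 * b - (t - k)) * p (t - k) \<le> p (2 * b)"
    using p_add_ge[of "t - k" "2 * b - (t - k)"] ab assms by simp
  have 3: "c ^ (t - (2 * a + 2 * b - 2)) * p (2 * a + 2 * b - 2) \<le> p t"
    using p_add_ge[of "2 * a + 2 * b - 2" "t - (2 * a + 2 * b - 2)"] ab(5,6)
    by (simp only: le_add_diff_inverse Suc_le_eq One_nat_def)
  have 4: "p (2 * a) * p (2 * b) \<le> p 2 * p (2 * a + 2 * b - 2)"
  proof (cases "a \<le> b")
    case True
    moreover have "2 * (a + b - 1) = 2 * a + 2 * b - 2" by simp
    ultimately show ?thesis using p_even_merge_le[of a b] ab(1) by (simp only:)
  next
    case False
    moreover have "2 * (b + a - 1) = 2 * a + 2 * b - 2" by simp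
    ultimately show ?thesis
      using p_even_merge_le[of b a] ab(2) by (simp only: mult.commute[of "p (2 * a)"] not_le)
  qed
  let ?i = "2 * a - k" and ?j = "2 * b - (t - k)" and ?l = "t - (2 * a + 2 * b - 2)"
  have "c ^ 4 * (p k * p (t - k)) \<le> c ^ (?i + ?j + ?l) * (p k * p (t - k))"
    using s c p_nonneg by (intro mult_right_mono power_decreasing) auto
  also have "\<dots> = c ^ ?l * ((c ^ ?i * p k) * (c ^ ?j * p (t - k)))"
    by (simp add: power_add mult_ac)
  also have "\<dots> \<le> c ^ ?l * (p (2 * a) * p (2 * b))"
    using 1 2 c p_nonneg by (intro mult_left_mono mult_mono) auto
  also have "\<dots> \<le> c ^ ?l * (p 2 * p (2 * a + 2 * b - 2))"
    using 4 c by (intro mult_left_mono) auto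
  also have "\<dots> \<le> p 2 * p t"
    using 3 p_nonneg[of 2] by (simp add: mult_left_mono mult.left_commute)
  finally show ?thesis
    using p_2 c d_pos by (simp add: field_simps)
qed

subsection \<open>Cycles\<close>

abbreviation hom :: "nat \<Rightarrow> nat" where
  "hom t \<equiv> hom_count (cycle_verts t) (cycle_adj t) V E"

abbreviation mon :: "nat \<Rightarrow> nat" where
  "mon t \<equiv> mon_count (cycle_verts t) (cycle_adj t) V E"

lemma hom_ge:
  assumes "0 < t" shows "N * p t * real d ^ t \<le> hom t"
proof -
  have "N * p t * real d ^ t = (\<Sum>x\<in>V. P t x x * real d ^ t)"
    by (simp add: P_diag N_def)
  also have "\<dots> = real (\<Sum>x\<in>V. nwalks V E t x x)"
    by (simp add: nwalks_eq)
  also have "\<dots> \<le> hom t"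
    using hom_count_cycle_ge[OF finite_V, of E t] adj_sym assms by (intro of_nat_mono) auto
  finally show ?thesis .
qed

lemma hom_pos: "2 \<le> t \<Longrightarrow> 0 < hom t"
proof -
  assume t: "2 \<le> t"
  have "0 < N * p t * real d ^ t" using p_pos[OF t] N_pos d_pos by simp
  then show ?thesis using hom_ge[of t] t by linarith
qed

text \<open>The closed walk between \<open>a\<close> and \<open>b\<close> contributes
  \<open>p (b - a)\<close> whatever its base vertex \<open>z\<close> is; the two outer walks join to
  a closed walk at \<open>z\<close> of length \<open>t - (b - a)\<close>.\<close>

lemma collision_le:
  assumes "a < b" "b < t"
  shows "real (card {\<phi> \<in> homs (cycle_verts t) (cycle_adj t) V E. \<phi> a = \<phi> b})
    \<le> N * real d ^ t * (p (b - a) * p (t - (b - a)))"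
proof -
  let ?W = "nwalks V E"
  have "real (card {\<phi> \<in> homs (cycle_verts t) (cycle_adj t) V E. \<phi> a = \<phi> b})
      \<le> real (\<Sum>x\<in>V. \<Sum>z\<in>V. ?W a x z * ?W (b - a) z z * ?W (t - b) z x)"
    using card_cycle_homs_collision_le[OF finite_V assms] by (rule of_nat_mono)
  also have "\<dots> = (\<Sum>x\<in>V. \<Sum>z\<in>V. real d ^ t * (p (b - a) * (P (t - b) z x * P a x z)))"
  proof -
    have "real (?W a x z * ?W (b - a) z z * ?W (t - b) z x)
        = real d ^ t * (p (b - a) * (P (t - b) z x * P a x z))" if "z \<in> V" for x z
    proof -
      have "t = a + (b - a) + (t - b)" using assms by simp
      then have "real d ^ t = real d ^ a * real d ^ (b - a) * real d ^ (t - b)"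
        by (simp flip: power_add)
      then show ?thesis using that by (simp add: nwalks_eq P_diag mult_ac)
    qed
    then show ?thesis by simp
  qed
  also have "\<dots> = real d ^ t * (p (b - a) * (\<Sum>z\<in>V. \<Sum>x\<in>V. P (t - b) z x * P a x z))"
    by (subst sum.swap) (simp add: sum_distrib_left)
  also have "(\<Sum>z\<in>V. \<Sum>x\<in>V. P (t - b) z x * P a x z) = (\<Sum>z\<in>V. p (t - (b - a)))"
  proof (intro sum.cong refl)
    fix z assume z: "z \<in> V"
    have "t - (b - a) = t - b + a" using assms by simp
    then show "(\<Sum>x\<in>V. P (t - b) z x * P a x z) = p (t - (b - a))"
      using P_add[OF z, of "t - b" a z] P_diag[OF z] by simp
  qed
  finally show ?thesis by (simp add: N_def mult_ac)
qed

lemma mon_le_hom: "mon t \<le> hom t"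
  unfolding mon_count_def hom_count_def
  using finite_homs_cycle[OF finite_V] by (intro card_mono) auto

text \<open>Union bound over colliding pairs. The bound for a pair depends only on the gap
  \<open>k = b - a\<close>, and each \<open>b\<close> meets every gap at most once, whence the
  factor \<open>t\<close>.\<close>

lemma hom_minus_mon_le:
  "real (hom t) - real (mon t) \<le> N * real d ^ t * (t * (\<Sum>k\<in>{1..<t}. p k * p (t - k)))"
proof -
  let ?H = "homs (cycle_verts t) (cycle_adj t) V E"
  let ?M = "{\<phi> \<in> ?H. inj_on \<phi> (cycle_verts t)}"
  have fin: "finite ?H" by (rule finite_homs_cycle[OF finite_V])
  have sub: "?H - ?M \<subseteq> (\<Union>b\<in>{..<t}. \<Union>a\<in>{..<b}. {\<phi> \<in> ?H. \<phi> a = \<phi> b})"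
  proof
    fix \<phi> assume \<phi>: "\<phi> \<in> ?H - ?M"
    then have "\<not> inj_on \<phi> {0..<t}" by (simp add: cycle_verts_def)
    then obtain a b where ab: "a < b" "b < t" "\<phi> a = \<phi> b"
      using linorder_inj_onI'[of "{0..<t}" \<phi>] by auto
    with \<phi> show "\<phi> \<in> (\<Union>b\<in>{..<t}. \<Union>a\<in>{..<b}. {\<phi> \<in> ?H. \<phi> a = \<phi> b})"
      by (intro UN_I[of b] UN_I[of a]) auto
  qed
  have "real (hom t) - real (mon t) = real (card (?H - ?M))"
    using fin mon_le_hom[of t]
    by (subst card_Diff_subset) (auto simp: hom_count_def mon_count_def)
  also have "card (?H - ?M) \<le> card (\<Union>b\<in>{..<t}. \<Union>a\<in>{..<b}. {\<phi> \<in> ?H. \<phi> a = \<phi> b})"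
    using fin by (intro card_mono[OF _ sub]) auto
  also have "\<dots> \<le> (\<Sum>b\<in>{..<t}. card (\<Union>a\<in>{..<b}. {\<phi> \<in> ?H. \<phi> a = \<phi> b}))"
    by (intro card_UN_le) auto
  also have "\<dots> \<le> (\<Sum>b\<in>{..<t}. \<Sum>a\<in>{..<b}. card {\<phi> \<in> ?H. \<phi> a = \<phi> b})"
    by (intro sum_mono card_UN_le) auto
  also have "real \<dots> \<le> (\<Sum>b\<in>{..<t}. \<Sum>a\<in>{..<b}.
      N * real d ^ t * (p (b - a) * p (t - (b - a))))"
    unfolding of_nat_sum by (intro sum_mono collision_le) auto
  also have "\<dots> \<le> (\<Sum>b\<in>{..<t}. \<Sum>k\<in>{1..<t}. N * real d ^ t * (p k * p (t - k)))"
  proof (intro sum_mono)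
    fix b assume b: "b \<in> {..<t}"
    have "(\<Sum>a\<in>{..<b}. N * real d ^ t * (p (b - a) * p (t - (b - a))))
        = (\<Sum>k\<in>{1..b}. N * real d ^ t * (p k * p (t - k)))"
      by (rule sum.reindex_bij_witness[of _ "\<lambda>k. b - k" "\<lambda>a. b - a"]) auto
    also have "\<dots> \<le> (\<Sum>k\<in>{1..<t}. N * real d ^ t * (p k * p (t - k)))"
      using b N_pos p_nonneg by (intro sum_mono2) auto
    finally show "(\<Sum>a\<in>{..<b}. N * real d ^ t * (p (b - a) * p (t - (b - a))))
        \<le> (\<Sum>k\<in>{1..<t}. N * real d ^ t * (p k * p (t - k)))" .
  qed
  also have "\<dots> = N * real d ^ t * (t * (\<Sum>k\<in>{1..<t}. p k * p (t - k)))"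
    by (simp add: sum_distrib_left[symmetric] mult_ac)
  finally show ?thesis by simp
qed

text \<open>The common form of both lower bounds: any estimate of the collision sum relative to
  \<open>p t\<close> becomes a relative error, because \<open>hom t\<close> is at least
  \<open>N * p t * real d ^ t\<close>.\<close>

lemma mon_ratio_ge:
  assumes "3 \<le> t" and sum: "(\<Sum>k\<in>{1..<t}. p k * p (t - k)) \<le> B * p t"
  shows "1 - t * B \<le> real (mon t) / real (hom t)"
proof -
  have hom: "0 < real (hom t)" using hom_pos[of t] assms(1) by simp
  have pos: "0 < N * p t * real d ^ t" using p_pos[of t] N_pos d_pos assms(1) by simp
  \<comment> \<open>\<open>B\<close> must be nonnegative to multiply \<open>hom_ge\<close> by it;
    this follows from the bound that it satisfies.\<close>
  have "0 \<le> (\<Sum>k\<in>{1..<t}. p k * p (t - k))" using p_nonneg by (simp add: sum_nonneg)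
  with sum have "0 \<le> B * p t" by linarith
  then have B: "0 \<le> B" using p_pos[of t] assms(1) by (simp add: zero_le_mult_iff)
  have "real (hom t) - real (mon t) \<le> N * real d ^ t * (t * (\<Sum>k\<in>{1..<t}. p k * p (t - k)))"
    by (rule hom_minus_mon_le)
  also have "\<dots> \<le> N * real d ^ t * (t * (B * p t))"
    using sum N_pos by (intro mult_left_mono) auto
  also have "\<dots> = t * B * (N * p t * real d ^ t)" by simp
  also have "\<dots> \<le> t * B * real (hom t)"
    using hom_ge[of t] assms(1) B by (intro mult_left_mono) auto
  finally show ?thesis using hom by (simp add: field_simps)
qed

text \<open>No mixing is required here: each gap contributes at most \<open>1 / (c ^ 4 * d)\<close>
  relative to \<open>p t\<close>. The bound is useful while \<open>t\<close> is small compared with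
  the square root of \<open>d\<close>.\<close>

lemma mon_ratio_ge_short:
  assumes "3 \<le> t"
  shows "1 - (real t)\<^sup>2 / (c ^ 4 * d) \<le> real (mon t) / real (hom t)"
proof -
  have "(\<Sum>k\<in>{1..<t}. p k * p (t - k)) \<le> (\<Sum>k\<in>{1..<t}. p t / (c ^ 4 * d))"
    using p_merge_le assms by (intro sum_mono) auto
  also have "\<dots> \<le> real t / (c ^ 4 * d) * p t"
    using mult_right_mono[of "real (t - 1)" t "p t / (c ^ 4 * d)"] p_nonneg[of t] c by simp
  finally show ?thesis
    using mon_ratio_ge[OF assms, of "real t / (c ^ 4 * d)"] by (simp add: power2_eq_square)
qed

text \<open>The hypothesis \<open>mix\<close> says that the geometric error has fallen below
  \<open>\<eta> / N\<close> after \<open>l\<close> steps.\<close>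

lemma p_le_of_long:
  assumes mix: "N * \<gamma> ^ l \<le> \<eta> * (1 - \<alpha>)" and xy: "x \<in> V" "y \<in> V" and k: "0 < k" "l \<le> k"
  shows "P k x y \<le> (1 + \<eta>) / N"
proof -
  have "N * \<gamma> ^ k \<le> N * \<gamma> ^ l"
    using k \<gamma> N_pos by (intro mult_left_mono power_decreasing) auto
  with mix have "N * \<gamma> ^ k \<le> \<eta> * (1 - \<alpha>)" by linarith
  then have *: "\<gamma> ^ k / (1 - \<alpha>) \<le> \<eta> / N"
    using N_pos \<alpha> by (simp add: field_simps)
  have "\<gamma> ^ k / ((1 - \<alpha>) * d) \<le> \<gamma> ^ k / (1 - \<alpha>)"
    using \<alpha> \<gamma> d_pos by (intro divide_left_mono) auto
  then show ?thesis
    using P_upper[OF xy k(1)] * by (simp add: add_divide_distrib)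
qed

lemma p_ge_of_long:
  assumes mix: "N * \<gamma> ^ l \<le> \<eta> * (1 - \<alpha>)" and k: "l \<le> k"
  shows "(1 - \<eta>) / N \<le> p k"
proof -
  have "N \<ge> 1" using N_pos by (simp add: N_def)
  then have "\<gamma> ^ k \<le> N * \<gamma> ^ l"
    using k \<gamma> mult_mono[of 1 N "\<gamma> ^ k" "\<gamma> ^ l"] by (simp add: power_decreasing)
  with mix have "\<gamma> ^ k / (1 - \<alpha>) \<le> \<eta>"
    using \<alpha> by (simp add: field_simps)
  then have "(1 - \<eta>) / N \<le> (1 - \<gamma> ^ k / (1 - \<alpha>)) / N"
    using N_pos by (intro divide_right_mono) auto
  then show ?thesis using p_lower[of k] by linarith
qed

text \<open>The uniform part adds up to at most \<open>t / N\<close>; the errors form a geometric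
  series.\<close>

lemma sum_p_le:
  "(\<Sum>k\<in>{1..<t}. p k) \<le> t / N + 1 / ((1 - \<alpha>) * (1 - \<gamma>) * d)"
proof -
  have "(\<Sum>k\<in>{1..<t}. p k) \<le> (\<Sum>k\<in>{1..<t}. 1 / N + \<gamma> ^ k / ((1 - \<alpha>) * d))"
    using p_upper by (intro sum_mono) auto
  also have "\<dots> = real (t - 1) / N + (\<Sum>k\<in>{1..<t}. \<gamma> ^ k) / ((1 - \<alpha>) * d)"
    by (simp add: sum.distrib sum_divide_distrib)
  also have "\<dots> \<le> t / N + (1 / (1 - \<gamma>)) / ((1 - \<alpha>) * d)"
  proof (intro add_mono divide_right_mono)
    have "(\<Sum>k\<in>{1..<t}. \<gamma> ^ k) \<le> (\<Sum>k\<in>{..<t}. \<gamma> ^ k)"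
      using \<gamma> by (intro sum_mono2) auto
    also have "\<dots> \<le> (\<Sum>k. \<gamma> ^ k)"
      using \<gamma> by (intro sum_le_suminf summable_geometric) auto
    also have "\<dots> = 1 / (1 - \<gamma>)"
      using \<gamma> by (intro suminf_geometric) auto
    finally show "(\<Sum>k\<in>{1..<t}. \<gamma> ^ k) \<le> 1 / (1 - \<gamma>)" .
  qed (use N_pos \<alpha> in auto)
  finally show ?thesis by (simp add: mult_ac)
qed

text \<open>One of \<open>k\<close> and \<open>t - k\<close> is at least \<open>t div 2\<close>, so
  that factor has already mixed and is at most \<open>4 * p t\<close>. The other factor is
  controlled by \<open>sum_p_le\<close>, once for each side, which gives the constant 8.\<close>

lemma mon_ratio_ge_long:
  assumes "3 \<le> t" and mix: "N * \<gamma> ^ (t div 2) \<le> 1 / 2 * (1 - \<alpha>)"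
  shows "1 - 8 * ((real t)\<^sup>2 / N + real t / ((1 - \<alpha>) * (1 - \<gamma>) * d))
    \<le> real (mon t) / real (hom t)"
proof -
  obtain x where x: "x \<in> V" using ex_V by blast
  have half: "p k \<le> 2 / N" if "0 < k" "t div 2 \<le> k" for k
  proof -
    have "p k \<le> (1 + 1 / 2) / N"
      using p_le_of_long[OF mix x x that] P_diag[OF x] by simp
    also have "\<dots> \<le> 2 / N" using N_pos by (intro divide_right_mono) auto
    finally show ?thesis .
  qed
  have pt: "2 / N \<le> 4 * p t"
    using p_ge_of_long[OF mix, of t] by simp
  have "p k * p (t - k) \<le> 4 * p t * (p k + p (t - k))" if "k \<in> {1..<t}" for k
  proof (cases "t div 2 \<le> k")
    case True
    then have "p k \<le> 4 * p t" using half[of k] that pt by auto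
    then have "p k * p (t - k) \<le> 4 * p t * p (t - k)"
      by (intro mult_right_mono p_nonneg)
    also have "\<dots> \<le> 4 * p t * (p k + p (t - k))"
      using p_nonneg by (intro mult_left_mono) auto
    finally show ?thesis .
  next
    case False
    then have "t div 2 \<le> t - k" by linarith
    then have "p (t - k) \<le> 4 * p t" using half[of "t - k"] that pt by auto
    then have "p k * p (t - k) \<le> p k * (4 * p t)"
      by (intro mult_left_mono p_nonneg)
    also have "\<dots> \<le> (p k + p (t - k)) * (4 * p t)"
      using p_nonneg by (intro mult_right_mono) auto
    finally show ?thesis by (simp add: mult_ac)
  qed
  then have "(\<Sum>k\<in>{1..<t}. p k * p (t - k)) \<le> (\<Sum>k\<in>{1..<t}. 4 * p t * (p k + p (t - k)))"
    by (rule sum_mono)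
  also have "\<dots> = 4 * p t * ((\<Sum>k\<in>{1..<t}. p k) + (\<Sum>k\<in>{1..<t}. p (t - k)))"
    by (simp add: sum_distrib_left[symmetric] sum.distrib)
  also have "(\<Sum>k\<in>{1..<t}. p (t - k)) = (\<Sum>k\<in>{1..<t}. p k)"
    by (rule sum.reindex_bij_witness[of _ "\<lambda>k. t - k" "\<lambda>k. t - k"]) auto
  also have "4 * p t * ((\<Sum>k\<in>{1..<t}. p k) + (\<Sum>k\<in>{1..<t}. p k))
      \<le> 4 * p t * (2 * (t / N + 1 / ((1 - \<alpha>) * (1 - \<gamma>) * d)))"
    using sum_p_le[of t] p_nonneg[of t] by (intro mult_left_mono) auto
  also have "\<dots> = 8 * (t / N + 1 / ((1 - \<alpha>) * (1 - \<gamma>) * d)) * p t"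
    by (simp add: algebra_simps)
  finally have "(\<Sum>k\<in>{1..<t}. p k * p (t - k))
      \<le> 8 * (t / N + 1 / ((1 - \<alpha>) * (1 - \<gamma>) * d)) * p t" .
  from mon_ratio_ge[OF assms(1) this] show ?thesis
    by (simp add: algebra_simps power2_eq_square)
qed

section \<open>Self-avoiding walks and the upper bound for monomorphisms\<close>

abbreviation saw :: "nat \<Rightarrow> nat" where "saw L \<equiv> card (self_avoiding V E L)"

lemma saw_0: "real (saw 0) \<le> N"
proof -
  have "self_avoiding V E 0 \<subseteq> (\<lambda>x. [x]) ` V"
    by (auto simp: self_avoiding_def length_Suc_conv)
  then have "saw 0 \<le> card V" by (rule surj_card_le[OF finite_V])
  then show ?thesis by (simp add: N_def)
qed

text \<open>\<open>\<delta>\<close> bounds from below the probability that \<open>k\<close> further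
  random steps end on a visited vertex. Of the extension, only its endpoint is required to avoid the
  earlier vertices.\<close>

lemma saw_extend_le:
  assumes "0 < k"
    and hit: "\<And>xs. xs \<in> self_avoiding V E L \<Longrightarrow> \<delta> \<le> (\<Sum>y\<in>set xs. P k (last xs) y)"
  shows "real (saw (L + k)) \<le> saw L * (real d ^ k * (1 - \<delta>))"
proof -
  \<comment> \<open>Both parts contain the entry at index \<open>L\<close>: it ends the old walk and
    starts the extension.\<close>
  define f where "f xs = (take (Suc L) xs, drop L xs)" for xs :: "'a list"
  define T where "T = (SIGMA xs:self_avoiding V E L. \<Union>y\<in>V - set xs. walks V E k (last xs) y)"
  have last_in: "last xs \<in> V" "set xs \<subseteq> V" if "xs \<in> self_avoiding V E L" for xs
    using that last_in_set[of xs] by (cases xs; auto simp: self_avoiding_def)+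
  have "inj_on f (self_avoiding V E (L + k))"
  proof (rule inj_onI)
    fix xs ys assume "f xs = f ys"
    then have "take (Suc L) xs = take (Suc L) ys" "drop (Suc L) xs = drop (Suc L) ys"
      by (auto simp: f_def drop_Suc simp flip: tl_drop)
    then show "xs = ys" by (metis append_take_drop_id)
  qed
  moreover have "f ` self_avoiding V E (L + k) \<subseteq> T"
  proof (rule image_subsetI)
    fix xs assume "xs \<in> self_avoiding V E (L + k)"
    then have len: "length xs = Suc (L + k)" and sub: "set xs \<subseteq> V" and succ: "successively E xs"
      and dist: "distinct xs"
      by (auto simp: self_avoiding_def)
    have split: "xs = take (Suc L) xs @ drop (Suc L) xs" by simp
    have last_take: "last (take (Suc L) xs) = xs ! L"
      using len by (subst last_conv_nth) (auto simp: min_def)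
    have hd_drop: "hd (drop L xs) = xs ! L" using len by (simp add: hd_drop_conv_nth)
    have last: "last (drop L xs) = last (drop (Suc L) xs)"
      using len assms(1) by (simp add: last_drop)
    have "last (drop (Suc L) xs) \<in> set (drop (Suc L) xs)"
      using len assms(1) by (intro last_in_set) simp
    moreover have "set (take (Suc L) xs) \<inter> set (drop (Suc L) xs) = {}"
      using dist by (subst (asm) split) (simp only: distinct_append)
    ultimately have "last (drop L xs) \<in> V - set (take (Suc L) xs)"
      using sub last set_drop_subset[of "Suc L" xs] by auto
    moreover have "drop L xs \<in> walks V E k (last (take (Suc L) xs)) (last (drop L xs))"
      using len sub succ set_drop_subset[of L xs] last_take hd_drop
      by (auto simp: walks_def successively_conv_nth)
    moreover have "take (Suc L) xs \<in> self_avoiding V E L"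
      using len sub succ dist set_take_subset[of "Suc L" xs]
      by (auto simp: self_avoiding_def successively_conv_nth)
    ultimately show "f xs \<in> T" by (auto simp: f_def T_def)
  qed
  moreover have "finite T"
    unfolding T_def using finite_V by (auto simp: finite_walks finite_self_avoiding)
  ultimately have "saw (L + k) \<le> card T" by (rule card_inj_on_le)
  also have "card T = (\<Sum>xs\<in>self_avoiding V E L. card (\<Union>y\<in>V - set xs. walks V E k (last xs) y))"
    unfolding T_def using finite_V
    by (subst card_SigmaI) (auto simp: finite_walks finite_self_avoiding)
  also have "\<dots> \<le> (\<Sum>xs\<in>self_avoiding V E L. \<Sum>y\<in>V - set xs. nwalks V E k (last xs) y)"
  proof (intro sum_mono)
    fix xs assume xs: "xs \<in> self_avoiding V E L"
    have "card (\<Union>y\<in>V - set xs. walks V E k (last xs) y)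
        \<le> (\<Sum>y\<in>V - set xs. card (walks V E k (last xs) y))"
      using finite_V by (intro card_UN_le) auto
    then show "card (\<Union>y\<in>V - set xs. walks V E k (last xs) y)
        \<le> (\<Sum>y\<in>V - set xs. nwalks V E k (last xs) y)"
      using last_in[OF xs] finite_V by (simp add: card_walks)
  qed
  finally have "real (saw (L + k))
      \<le> (\<Sum>xs\<in>self_avoiding V E L. \<Sum>y\<in>V - set xs. real (nwalks V E k (last xs) y))"
    by (simp flip: of_nat_sum)
  also have "\<dots> \<le> (\<Sum>xs\<in>self_avoiding V E L. real d ^ k * (1 - \<delta>))"
  proof (rule sum_mono)
    fix xs assume xs: "xs \<in> self_avoiding V E L"
    have "(\<Sum>y\<in>V - set xs. real (nwalks V E k (last xs) y))
        = real d ^ k * (\<Sum>y\<in>V - set xs. P k (last xs) y)"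
      by (simp add: nwalks_eq sum_distrib_left mult.commute)
    also have "(\<Sum>y\<in>V - set xs. P k (last xs) y) = 1 - (\<Sum>y\<in>set xs. P k (last xs) y)"
      using last_in[OF xs] finite_V by (simp add: sum_diff P_row)
    also have "real d ^ k * \<dots> \<le> real d ^ k * (1 - \<delta>)"
      using hit[OF xs] by (intro mult_left_mono) auto
    finally show "(\<Sum>y\<in>V - set xs. real (nwalks V E k (last xs) y)) \<le> real d ^ k * (1 - \<delta>)" .
  qed
  finally show ?thesis by simp
qed

lemma saw_le:
  assumes "0 < L" shows "real (saw L) \<le> N * real d ^ L"
proof -
  have "real (saw (0 + L)) \<le> saw 0 * (real d ^ L * (1 - 0))"
    using assms by (intro saw_extend_le) (auto simp: P_nonneg sum_nonneg)
  also have "\<dots> \<le> N * (real d ^ L * (1 - 0))"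
    using saw_0 by (intro mult_right_mono) auto
  finally show ?thesis by simp
qed

text \<open>Each step after the first must not go back to the preceding vertex, at index
  \<open>L\<close>, which a random step hits with probability \<open>1 / d\<close>. The first step
  is free, hence \<open>Suc L\<close> edges but only \<open>L\<close> in the exponent.\<close>

lemma saw_le_exp_degree: "real (saw (Suc L)) \<le> N * real d ^ Suc L * exp (- (L / d))"
proof (induction L)
  case 0
  then show ?case using saw_le[of 1] by simp
next
  case (Suc L)
  have "real (saw (Suc L + 1)) \<le> saw (Suc L) * (real d ^ 1 * (1 - 1 / d))"
  proof (rule saw_extend_le)
    fix xs assume xs: "xs \<in> self_avoiding V E (Suc L)"
    then have len: "length xs = Suc (Suc L)" and "set xs \<subseteq> V"
      by (auto simp: self_avoiding_def)
    then have in_set: "xs ! L \<in> set xs" "xs ! L \<in> V" by auto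
    have "E (xs ! L) (xs ! Suc L)"
      using xs by (auto simp: self_avoiding_def successively_conv_nth)
    moreover have "last xs = xs ! Suc L"
      using len by (subst last_conv_nth) auto
    ultimately have "P 1 (last xs) (xs ! L) = 1 / d"
      using adj_sym in_set by (subst P_1) auto
    then show "1 / d \<le> (\<Sum>y\<in>set xs. P 1 (last xs) y)"
      using member_le_sum[OF in_set(1), of "P 1 (last xs)"] P_nonneg by simp
  qed simp
  also have "\<dots> \<le> (N * real d ^ Suc L * exp (- (L / d))) * (real d ^ 1 * exp (- (1 / d)))"
    using Suc exp_ge_add_one_self[of "- (1 / d)"] d_pos N_pos
    by (intro mult_mono) (auto simp: field_simps)
  also have "\<dots> = N * real d ^ Suc (Suc L) * exp (- (L / d) + - (1 / d))"
    by (simp only: exp_add power_Suc power_one_right mult_ac)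
  also have "- (L / d) + - (1 / d) = - (Suc L / d)"
    by (simp add: add_divide_distrib)
  finally show ?case by simp
qed

text \<open>After the first \<open>M\<close> steps more than \<open>M\<close> vertices are taken,
  and by \<open>minor\<close> each is hit by \<open>m\<close> further steps with probability at
  least \<open>\<alpha> / N\<close>. Every one of the \<open>q\<close> blocks therefore costs a
  factor \<open>1 - \<alpha> * M / N\<close>.\<close>

lemma saw_le_exp_verts:
  assumes "0 < M"
  shows "real (saw (M + q * m)) \<le> N * real d ^ (M + q * m) * exp (- (\<alpha> * M * q / N))"
proof (induction q)
  case 0
  then show ?case using saw_le[OF assms] by simp
next
  case (Suc q)
  have "real (saw (M + q * m + m)) \<le> saw (M + q * m) * (real d ^ m * (1 - \<alpha> * M / N))"
  proof (rule saw_extend_le)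
    fix xs assume xs: "xs \<in> self_avoiding V E (M + q * m)"
    then have len: "length xs = Suc (M + q * m)" "distinct xs" and sub: "set xs \<subseteq> V"
      by (auto simp: self_avoiding_def)
    then have "card (set xs) = Suc (M + q * m)" by (simp add: distinct_card)
    then have "\<alpha> * M / N \<le> (\<Sum>y\<in>set xs. \<alpha> / N)"
      using \<alpha> N_pos by (simp add: divide_right_mono mult_left_mono mult.commute)
    also have "\<dots> \<le> (\<Sum>y\<in>set xs. P m (last xs) y)"
    proof (rule sum_mono)
      fix y assume "y \<in> set xs"
      moreover have "last xs \<in> set xs" using len by (intro last_in_set) auto
      ultimately show "\<alpha> / N \<le> P m (last xs) y" using sub by (intro minor) auto
    qed
    finally show "\<alpha> * M / N \<le> (\<Sum>y\<in>set xs. P m (last xs) y)" .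
  qed (rule m_pos)
  also have "\<dots> \<le> saw (M + q * m) * (real d ^ m * exp (- (\<alpha> * M / N)))"
    using exp_ge_add_one_self[of "- (\<alpha> * M / N)"] by (intro mult_left_mono) auto
  also have "\<dots> \<le> (N * real d ^ (M + q * m) * exp (- (\<alpha> * M * q / N)))
      * (real d ^ m * exp (- (\<alpha> * M / N)))"
    using Suc by (intro mult_right_mono) auto
  also have "\<dots> = N * real d ^ (M + q * m + m)
      * exp (- (\<alpha> * M * q / N) + - (\<alpha> * M / N))"
    by (simp only: exp_add power_add mult_ac)
  also have "- (\<alpha> * M * q / N) + - (\<alpha> * M / N) = - (\<alpha> * M * Suc q / N)"
    by (simp add: algebra_simps add_divide_distrib)
  finally show ?case by (simp add: add_ac)
qed

text \<open>There are \<open>N * real d ^ L\<close> walks of length \<open>L\<close>, so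
  \<open>B\<close> measures the loss through self-avoidance. The other part of the cycle has length
  at least \<open>t div 2\<close>, so it is mixed and its endpoint is uniform up to
  \<open>\<eta>\<close>.\<close>

lemma mon_ratio_le:
  assumes "3 \<le> t" and mix: "N * \<gamma> ^ (t div 2) \<le> \<eta> * (1 - \<alpha>)" and \<eta>: "0 < \<eta>" "\<eta> < 1"
    and L: "L < t" "t div 2 \<le> t - L"
    and saw: "real (saw L) \<le> N * real d ^ L * B"
  shows "real (mon t) / real (hom t) \<le> B * ((1 + \<eta>) / (1 - \<eta>))"
proof -
  have "real (mon t) \<le> saw L * ((1 + \<eta>) / N * real d ^ (t - L))"
  proof (rule mon_count_cycle_le[OF finite_V L(1)])
    fix x y assume "x \<in> V" "y \<in> V"
    then show "real (nwalks V E (t - L) x y) \<le> (1 + \<eta>) / N * real d ^ (t - L)"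
      unfolding nwalks_eq using p_le_of_long[OF mix] L by (intro mult_right_mono) auto
  qed
  also have "\<dots> \<le> N * real d ^ L * B * ((1 + \<eta>) / N * real d ^ (t - L))"
    using saw \<eta> N_pos by (intro mult_right_mono) auto
  also have "\<dots> = B * (1 + \<eta>) * (real d ^ L * real d ^ (t - L))"
    using N_pos by simp
  also have "real d ^ L * real d ^ (t - L) = real d ^ t"
    using L by (simp flip: power_add)
  finally have mon: "real (mon t) \<le> B * (1 + \<eta>) * real d ^ t" .
  have "(1 - \<eta>) / N * (N * real d ^ t) \<le> p t * (N * real d ^ t)"
    using p_ge_of_long[OF mix, of t] N_pos by (intro mult_right_mono) auto
  then have hom: "(1 - \<eta>) * real d ^ t \<le> hom t"
    using hom_ge[of t] assms(1) N_pos by (simp add: mult_ac)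
  have pos: "0 < (1 - \<eta>) * real d ^ t" using \<eta> d_pos by simp
  have "real (mon t) / real (hom t) \<le> real (mon t) / ((1 - \<eta>) * real d ^ t)"
    using hom pos by (intro divide_left_mono) (auto intro!: mult_pos_pos)
  also have "\<dots> \<le> B * (1 + \<eta>) * real d ^ t / ((1 - \<eta>) * real d ^ t)"
    using mon pos by (intro divide_right_mono) auto
  also have "\<dots> = B * ((1 + \<eta>) / (1 - \<eta>))"
    using d_pos by simp
  finally show ?thesis .
qed

end

section \<open>Generalized Johnson graphs\<close>

text \<open>Compare the product formulas factor by factor: \<open>n - i\<close> is at most twice
  \<open>n - a - i\<close> as long as \<open>2 * a + i\<close> is at most \<open>n\<close>.\<close>

lemma binomial_le_binomial_diff:
  assumes "2 * a + j \<le> n"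
  shows "real (n choose j) \<le> 2 ^ j * real ((n - a) choose j)"
proof -
  have "real (n choose j) = (\<Prod>i = 0..<j. real (n - i) / real (j - i))"
    using assms by (intro binomial_altdef_of_nat) auto
  also have "\<dots> \<le> (\<Prod>i = 0..<j. 2 * (real (n - a - i) / real (j - i)))"
  proof (intro prod_mono conjI)
    fix i assume i: "i \<in> {0..<j}"
    then have "real (n - i) \<le> 2 * real (n - a - i)"
      using assms by (simp add: of_nat_diff)
    then have "real (n - i) / real (j - i) \<le> 2 * real (n - a - i) / real (j - i)"
      by (intro divide_right_mono) auto
    then show "real (n - i) / real (j - i) \<le> 2 * (real (n - a - i) / real (j - i))" by simp
  qed auto
  also have "\<dots> = 2 ^ j * (\<Prod>i = 0..<j. real (n - a - i) / real (j - i))"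
    by (simp only: prod.distrib) simp
  also have "(\<Prod>i = 0..<j. real (n - a - i) / real (j - i)) = real ((n - a) choose j)"
    using assms by (intro binomial_altdef_of_nat[symmetric]) auto
  finally show ?thesis .
qed

text \<open>Bijections of \<open>A\<close>, of \<open>B\<close> and of the complement are glued
  together. With \<open>B\<close> empty this moves any vertex to any other; with
  \<open>A = A'\<close> it moves vertices disjoint from a fixed one.\<close>

lemma ex_bij_betw_images:
  assumes U: "finite U" and sub: "A \<subseteq> U" "B \<subseteq> U" "A' \<subseteq> U" "B' \<subseteq> U"
    and disj: "A \<inter> B = {}" "A' \<inter> B' = {}" and card: "card A = card A'" "card B = card B'"
  shows "\<exists>\<pi>. bij_betw \<pi> U U \<and> \<pi> ` A = A' \<and> \<pi> ` B = B'"
proof -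
  have fin: "finite A" "finite B" "finite A'" "finite B'"
    using sub U finite_subset by blast+
  obtain f where f: "bij_betw f A A'"
    using finite_same_card_bij[OF fin(1,3) card(1)] by blast
  obtain g where g: "bij_betw g B B'"
    using finite_same_card_bij[OF fin(2,4) card(2)] by blast
  have "card (U - (A \<union> B)) = card (U - (A' \<union> B'))"
    using U sub disj card fin by (simp add: card_Diff_subset card_Un_disjoint)
  then obtain h where h: "bij_betw h (U - (A \<union> B)) (U - (A' \<union> B'))"
    using finite_same_card_bij[of "U - (A \<union> B)" "U - (A' \<union> B')"] U by blast
  define fg where "fg x = (if x \<in> A then f x else g x)" for x
  define \<pi> where "\<pi> x = (if x \<in> A \<union> B then fg x else h x)" for x
  have "bij_betw fg (A \<union> B) (A' \<union> B')"
    unfolding fg_def using f g disj by (intro bij_betw_disjoint_Un) auto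
  then have "bij_betw \<pi> ((A \<union> B) \<union> (U - (A \<union> B))) ((A' \<union> B') \<union> (U - (A' \<union> B')))"
    unfolding \<pi>_def using h by (intro bij_betw_disjoint_Un) auto
  moreover have "(A \<union> B) \<union> (U - (A \<union> B)) = U" "(A' \<union> B') \<union> (U - (A' \<union> B')) = U"
    using sub by auto
  moreover have "\<pi> ` A = f ` A"
    by (intro image_cong) (auto simp: \<pi>_def fg_def)
  moreover have "\<pi> ` B = g ` B"
    using disj by (intro image_cong) (auto simp: \<pi>_def fg_def)
  ultimately show ?thesis
    using f g by (auto simp: bij_betw_def)
qed

lemma finite_johnson_verts: "finite (johnson_verts n r)"
  by (simp add: johnson_verts_def)

lemma card_johnson_verts: "card (johnson_verts n r) = n choose r"
  using n_subsets[of "{1..n}" r] by (simp add: johnson_verts_def)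

lemma johnson_vertsD:
  assumes "x \<in> johnson_verts n r" shows "x \<subseteq> {1..n}" "card x = r" "finite x"
  using assms finite_subset[of x "{1..n}"] by (auto simp: johnson_verts_def)

text \<open>A neighbour \<open>y\<close> is determined by the independent choices of
  \<open>x \<inter> y\<close> and \<open>y - x\<close>.\<close>

lemma card_johnson_nbrs:
  assumes "x \<in> johnson_verts n r" "s \<le> r"
  shows "card {y \<in> johnson_verts n r. johnson_adj s x y} = (r choose s) * ((n - r) choose (r - s))"
proof -
  note x = johnson_vertsD[OF assms(1)]
  let ?S = "{S. S \<subseteq> x \<and> card S = s}" and ?T = "{w. w \<subseteq> {1..n} - x \<and> card w = r - s}"
  let ?f = "\<lambda>(S, w). S \<union> w"
  have "{y \<in> johnson_verts n r. johnson_adj s x y} = ?f ` (?S \<times> ?T)"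
  proof (intro equalityI subsetI)
    fix y assume y: "y \<in> {y \<in> johnson_verts n r. johnson_adj s x y}"
    then have "card (y - x) = r - s"
      using johnson_vertsD[of y n r] by (auto simp: johnson_adj_def card_Diff_subset_Int Int_commute)
    with y show "y \<in> ?f ` (?S \<times> ?T)"
      by (intro image_eqI[of _ _ "(x \<inter> y, y - x)"]) (auto simp: johnson_adj_def johnson_verts_def)
  next
    fix y assume "y \<in> ?f ` (?S \<times> ?T)"
    then obtain S w where y: "y = S \<union> w" "S \<subseteq> x" "card S = s" "w \<subseteq> {1..n} - x" "card w = r - s"
      by auto
    then have "finite S" "finite w" "S \<inter> w = {}" "x \<inter> y = S"
      using x finite_subset[of w "{1..n} - x"] finite_subset[of S x] by auto
    then show "y \<in> {y \<in> johnson_verts n r. johnson_adj s x y}"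
      using x y assms(2) by (auto simp: johnson_verts_def johnson_adj_def card_Un_disjoint)
  qed
  moreover have "inj_on ?f (?S \<times> ?T)"
  proof (rule inj_onI)
    fix a b assume ab: "a \<in> ?S \<times> ?T" "b \<in> ?S \<times> ?T" and eq: "?f a = ?f b"
    obtain S w S' w' where [simp]: "a = (S, w)" "b = (S', w')" by (cases a, cases b)
    have "S = (S \<union> w) \<inter> x" "S' = (S' \<union> w') \<inter> x" "w = (S \<union> w) - x" "w' = (S' \<union> w') - x"
      using ab by auto
    with eq show "a = b" by auto
  qed
  ultimately have "card {y \<in> johnson_verts n r. johnson_adj s x y} = card ?S * card ?T"
    by (simp add: card_image card_cartesian_product)
  moreover have "card ({1..n} - x) = n - r"
    using x by (simp add: card_Diff_subset)
  ultimately show ?thesis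
    using n_subsets[of x s] n_subsets[of "{1..n} - x" "r - s"] x by simp
qed

text \<open>Take the neighbours \<open>S \<union> w\<close> with \<open>w\<close> outside
  \<open>x \<union> F\<close>. At most \<open>3 * r\<close> elements are forbidden for
  \<open>w\<close>. This serves both for leaving \<open>F\<close> and for finding triangles.\<close>

lemma johnson_nbrs_avoiding:
  assumes x: "x \<in> johnson_verts n r" and S: "S \<subseteq> x" "card S = s" and "s \<le> r"
    and F: "F \<subseteq> {1..n}" "card F \<le> 2 * r"
  shows "\<exists>Y \<subseteq> {y \<in> johnson_verts n r. johnson_adj s x y}.
    (n - 3 * r) choose (r - s) \<le> card Y \<and> (\<forall>y\<in>Y. y \<inter> F = S \<inter> F)"
proof -
  note x' = johnson_vertsD[OF x]
  let ?W = "{w. w \<subseteq> {1..n} - (x \<union> F) \<and> card w = r - s}"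
  have finS: "finite S" using S x' finite_subset by blast
  have disj: "S \<inter> w = {}" if "w \<in> ?W" for w using that S by auto
  have "inj_on (\<lambda>w. S \<union> w) ?W"
    using disj by (intro inj_onI) blast
  then have "card ((\<lambda>w. S \<union> w) ` ?W) = card ?W" by (rule card_image)
  also have "\<dots> = card ({1..n} - (x \<union> F)) choose (r - s)"
    by (rule n_subsets) simp
  also have "\<dots> \<ge> (n - 3 * r) choose (r - s)"
  proof (rule binomial_right_mono)
    have "card (x \<union> F) \<le> 3 * r" using card_Un_le[of x F] x' F by simp
    moreover have "card ({1..n} - (x \<union> F)) = n - card (x \<union> F)"
      using x' F finite_subset[OF F(1)] by (subst card_Diff_subset) auto
    ultimately show "n - 3 * r \<le> card ({1..n} - (x \<union> F))" by simp
  qed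
  finally have "(n - 3 * r) choose (r - s) \<le> card ((\<lambda>w. S \<union> w) ` ?W)" .
  moreover have "(\<lambda>w. S \<union> w) ` ?W \<subseteq> {y \<in> johnson_verts n r. johnson_adj s x y}"
  proof (rule image_subsetI)
    fix w assume w: "w \<in> ?W"
    then have "finite w" using finite_subset[of w "{1..n} - (x \<union> F)"] by auto
    then have "card (S \<union> w) = r"
      using w S \<open>s \<le> r\<close> finS disj[OF w] by (simp add: card_Un_disjoint)
    moreover have "x \<inter> (S \<union> w) = S" using w S by auto
    ultimately show "S \<union> w \<in> {y \<in> johnson_verts n r. johnson_adj s x y}"
      using w S x' by (auto simp: johnson_verts_def johnson_adj_def)
  qed
  moreover have "\<forall>y\<in>(\<lambda>w. S \<union> w) ` ?W. y \<inter> F = S \<inter> F" by auto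
  ultimately show ?thesis by (intro exI[of _ "(\<lambda>w. S \<union> w) ` ?W"]) auto
qed

section \<open>Walks in generalized Johnson graphs\<close>

abbreviation (input) johnson_walks :: "nat \<Rightarrow> nat \<Rightarrow> nat \<Rightarrow> nat \<Rightarrow> nat set \<Rightarrow> nat set \<Rightarrow> nat" where
  "johnson_walks n r s \<equiv> nwalks (johnson_verts n r) (johnson_adj s)"

lemma johnson_walks_permute:
  assumes \<pi>: "bij_betw \<pi> {1..n} {1..n}" and "x \<in> johnson_verts n r" "y \<in> johnson_verts n r"
  shows "johnson_walks n r s k (\<pi> ` x) (\<pi> ` y) = johnson_walks n r s k x y"
proof (rule nwalks_automorphism[OF _ _ assms(2,3)])
  have inj: "inj_on \<pi> {1..n}" and surj: "\<pi> ` {1..n} = {1..n}" using \<pi> by (auto simp: bij_betw_def)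
  show "bij_betw ((`) \<pi>) (johnson_verts n r) (johnson_verts n r)"
    unfolding bij_betw_def
  proof
    show injV: "inj_on ((`) \<pi>) (johnson_verts n r)"
      by (rule inj_on_subset[OF inj_on_image_Pow[OF inj]]) (auto simp: johnson_verts_def)
    have "(`) \<pi> ` johnson_verts n r \<subseteq> johnson_verts n r"
    proof (rule image_subsetI)
      fix z assume z: "z \<in> johnson_verts n r"
      then have "card (\<pi> ` z) = r"
        using inj_on_subset[OF inj] johnson_vertsD[OF z] by (simp add: card_image)
      then show "\<pi> ` z \<in> johnson_verts n r"
        using z surj by (auto simp: johnson_verts_def)
    qed
    then show "(`) \<pi> ` johnson_verts n r = johnson_verts n r"
      using injV finite_johnson_verts by (intro endo_inj_surj)
  qed
  fix a b assume ab: "a \<in> johnson_verts n r" "b \<in> johnson_verts n r"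
  then have "\<pi> ` a \<inter> \<pi> ` b = \<pi> ` (a \<inter> b)"
    using inj by (intro inj_on_image_Int[symmetric, of \<pi> "{1..n}"]) (auto simp: johnson_verts_def)
  moreover have "inj_on \<pi> (a \<inter> b)"
    using inj ab by (intro inj_on_subset[OF inj]) (auto simp: johnson_verts_def)
  ultimately show "johnson_adj s (\<pi> ` a) (\<pi> ` b) = johnson_adj s a b"
    by (simp add: johnson_adj_def card_image)
qed

lemma johnson_walks_homogeneous:
  assumes x: "x \<in> johnson_verts n r" and y: "y \<in> johnson_verts n r"
  shows "johnson_walks n r s k x x = johnson_walks n r s k y y"
proof -
  obtain \<pi> where "bij_betw \<pi> {1..n} {1..n}" "\<pi> ` x = y"
    using ex_bij_betw_images[of "{1..n}" x "{}" y "{}"] johnson_vertsD[OF x] johnson_vertsD[OF y]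
    by auto
  then show ?thesis using johnson_walks_permute[of \<pi> n x r x s k] x by simp
qed

text \<open>The stabiliser of \<open>x\<close> acts transitively on the vertices disjoint from
  \<open>x\<close>. A bound on the sum over these vertices thus gives a bound for each of
  them.\<close>

lemma johnson_walks_disjoint:
  assumes x: "x \<in> johnson_verts n r" and z: "z \<in> johnson_verts n r" "z \<inter> x = {}"
    and z': "z' \<in> johnson_verts n r" "z' \<inter> x = {}"
  shows "johnson_walks n r s k x z = johnson_walks n r s k x z'"
proof -
  obtain \<pi> where "bij_betw \<pi> {1..n} {1..n}" "\<pi> ` x = x" "\<pi> ` z = z'"
    using ex_bij_betw_images[of "{1..n}" x z x z'] johnson_vertsD[OF x] z z'
      johnson_vertsD[of z n r] johnson_vertsD[of z' n r]
    by (auto simp: Int_commute)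
  then show ?thesis using johnson_walks_permute[of \<pi> n x r z s k] x z by simp
qed

text \<open>Each step can get rid of one element of F and choose all new elements outside F.\<close>

lemma johnson_walks_escape:
  assumes "s < r" and F: "F \<subseteq> {1..n}" "card F \<le> 2 * r"
    and "x \<in> johnson_verts n r" "card (x \<inter> F) \<le> k"
  shows "((n - 3 * r) choose (r - s)) ^ k
    \<le> (\<Sum>z\<in>{z \<in> johnson_verts n r. z \<inter> F = {}}. johnson_walks n r s k x z)"
  using assms(4,5)
proof (induction k arbitrary: x)
  case 0
  then have "x \<in> {z \<in> johnson_verts n r. z \<inter> F = {}}"
    using johnson_vertsD(3)[OF 0(1)] by auto
  then show ?case
    using finite_johnson_verts[of n r] by simp
next
  case (Suc k)
  let ?V = "johnson_verts n r" and ?b = "(n - 3 * r) choose (r - s)"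
  let ?D = "{z \<in> ?V. z \<inter> F = {}}"
  note x = johnson_vertsD[OF Suc.prems(1)]
  have "x \<noteq> {}" using x \<open>s < r\<close> by auto
  \<comment> \<open>\<open>e\<close> is the element to be discarded in this step, taken from
    \<open>F\<close> whenever \<open>x\<close> meets \<open>F\<close>.\<close>
  then obtain e where e: "e \<in> x" "x \<inter> F \<noteq> {} \<Longrightarrow> e \<in> F" by blast
  have "s \<le> card (x - {e})" using x e \<open>s < r\<close> by simp
  then obtain S where S: "S \<subseteq> x - {e}" "card S = s" by (rule obtain_subset_with_card_n)
  have SF: "card (S \<inter> F) \<le> k"
  proof (cases "x \<inter> F = {}")
    case True
    then have "S \<inter> F = {}" using S by auto
    then show ?thesis by simp
  next
    case False
    then have "card (x \<inter> F - {e}) \<le> k" using e x Suc.prems(2) by simp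
    moreover have "card (S \<inter> F) \<le> card (x \<inter> F - {e})"
      using S x by (intro card_mono) auto
    ultimately show ?thesis by simp
  qed
  obtain Y where Y: "Y \<subseteq> {y \<in> ?V. johnson_adj s x y}" "?b \<le> card Y" "\<And>y. y \<in> Y \<Longrightarrow> y \<inter> F = S \<inter> F"
  proof -
    have "S \<subseteq> x" using S by blast
    from johnson_nbrs_avoiding[OF Suc.prems(1) this S(2) less_imp_le[OF \<open>s < r\<close>] F] that
    show thesis by blast
  qed
  have "?b ^ Suc k \<le> (\<Sum>y\<in>Y. ?b ^ k)" using Y(2) by simp
  also have "\<dots> \<le> (\<Sum>y\<in>Y. \<Sum>z\<in>?D. johnson_walks n r s k y z)"
    using Y SF by (intro sum_mono Suc.IH) auto
  also have "\<dots> \<le> (\<Sum>y\<in>{y \<in> ?V. johnson_adj s x y}. \<Sum>z\<in>?D. johnson_walks n r s k y z)"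
    using Y(1) finite_johnson_verts[of n r] by (intro sum_mono2) auto
  also have "\<dots> = (\<Sum>z\<in>?D. johnson_walks n r s (Suc k) x z)"
    by (subst sum.swap) simp
  finally show ?case .
qed

text \<open>Escape from \<open>F = x\<close> takes \<open>r\<close> steps. The sum over all disjoint
  endpoints has equal terms, and at most \<open>n choose r\<close> of them.\<close>

lemma johnson_walks_disjoint_ge:
  assumes "s < r" and x: "x \<in> johnson_verts n r" and z: "z \<in> johnson_verts n r" "z \<inter> x = {}"
  shows "((n - 3 * r) choose (r - s)) ^ r \<le> (n choose r) * johnson_walks n r s r x z"
proof -
  let ?D = "{z \<in> johnson_verts n r. z \<inter> x = {}}"
  have "((n - 3 * r) choose (r - s)) ^ r \<le> (\<Sum>z\<in>?D. johnson_walks n r s r x z)"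
    using johnson_vertsD[OF x] by (intro johnson_walks_escape[OF assms(1) _ _ x]) auto
  also have "\<dots> = (\<Sum>z'\<in>?D. johnson_walks n r s r x z)"
    using johnson_walks_disjoint[OF x] z by (intro sum.cong refl) blast
  also have "\<dots> \<le> (n choose r) * johnson_walks n r s r x z"
    using card_mono[of "johnson_verts n r" ?D] finite_johnson_verts[of n r] card_johnson_verts[of n r]
    by simp
  finally show ?thesis .
qed

text \<open>Route the walk through a midpoint disjoint from both \<open>x\<close> and
  \<open>y\<close>, with \<open>r\<close> steps on either side.\<close>

lemma johnson_walks_minor:
  assumes "s < r" and x: "x \<in> johnson_verts n r" and y: "y \<in> johnson_verts n r"
  shows "((n - 2 * r) choose r) * (((n - 3 * r) choose (r - s)) ^ r) ^ 2
    \<le> (n choose r) ^ 2 * johnson_walks n r s (2 * r) x y"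
proof -
  let ?V = "johnson_verts n r" and ?b = "(n - 3 * r) choose (r - s)"
  let ?D = "{z \<in> ?V. z \<inter> (x \<union> y) = {}}" and ?W = "johnson_walks n r s"
  note x' = johnson_vertsD[OF x] and y' = johnson_vertsD[OF y]
  have D: "?D = {z. z \<subseteq> {1..n} - (x \<union> y) \<and> card z = r}"
    by (auto simp: johnson_verts_def)
  have "(n - 2 * r) choose r \<le> card ({1..n} - (x \<union> y)) choose r"
  proof (rule binomial_right_mono)
    have "card (x \<union> y) \<le> 2 * r" using card_Un_le[of x y] x' y' by simp
    moreover have "card ({1..n} - (x \<union> y)) = n - card (x \<union> y)"
      using x' y' by (subst card_Diff_subset) auto
    ultimately show "n - 2 * r \<le> card ({1..n} - (x \<union> y))" by simp
  qed
  also have "\<dots> = card ?D" unfolding D by (rule n_subsets[symmetric]) simp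
  finally have "((n - 2 * r) choose r) * (?b ^ r) ^ 2 \<le> card ?D * (?b ^ r) ^ 2" by simp
  also have "\<dots> = (\<Sum>z\<in>?D. ?b ^ r * ?b ^ r)" by (simp add: power2_eq_square)
  also have "\<dots> \<le> (\<Sum>z\<in>?D. ((n choose r) * ?W r x z) * ((n choose r) * ?W r z y))"
    using assms by (intro sum_mono mult_mono johnson_walks_disjoint_ge) auto
  also have "\<dots> \<le> (\<Sum>z\<in>?V. ((n choose r) * ?W r x z) * ((n choose r) * ?W r z y))"
    using finite_johnson_verts[of n r] by (intro sum_mono2) auto
  also have "\<dots> = (n choose r) ^ 2 * (\<Sum>z\<in>?V. ?W r x z * ?W r z y)"
    by (simp add: sum_distrib_left power2_eq_square mult_ac)
  also have "(\<Sum>z\<in>?V. ?W r x z * ?W r z y) = ?W (2 * r) x y"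
    using nwalks_add[OF finite_johnson_verts x, of "johnson_adj s" r r y] by (simp add: mult_2)
  finally show ?thesis .
qed

text \<open>Choose neighbours \<open>z\<close> of \<open>x\<close> with
  \<open>z \<inter> y = x \<inter> y\<close>: they are adjacent to \<open>y\<close> as well.\<close>

lemma johnson_walks_codegree:
  assumes "s < r" and x: "x \<in> johnson_verts n r" and y: "y \<in> johnson_verts n r"
    and adj: "johnson_adj s x y"
  shows "(n - 3 * r) choose (r - s) \<le> johnson_walks n r s 2 x y"
proof -
  let ?V = "johnson_verts n r" and ?W = "johnson_walks n r s"
  have fin: "finite ?V" by (rule finite_johnson_verts)
  obtain Y where Y: "Y \<subseteq> {z \<in> ?V. johnson_adj s x z}" "(n - 3 * r) choose (r - s) \<le> card Y"
    "\<And>z. z \<in> Y \<Longrightarrow> z \<inter> y = x \<inter> y"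
    using johnson_nbrs_avoiding[OF x, of "x \<inter> y" s y] adj \<open>s < r\<close> johnson_vertsD[OF y]
    by (auto simp: johnson_adj_def)
  have one: "?W 1 z y = 1" if "z \<in> Y" for z
  proof -
    have "johnson_adj s z y" using Y(3)[OF that] adj by (simp add: johnson_adj_def)
    then show ?thesis using fin y by simp
  qed
  have "card Y = (\<Sum>z\<in>Y. ?W 1 z y)" using one by simp
  also have "\<dots> \<le> (\<Sum>z\<in>{z \<in> ?V. johnson_adj s x z}. ?W 1 z y)"
    using Y(1) fin by (intro sum_mono2) auto
  also have "\<dots> = ?W 2 x y" by (simp add: numeral_2_eq_2)
  finally show ?thesis using Y(2) by simp
qed

section \<open>Johnson graphs are mixing graphs\<close>

definition triangle_const :: "nat \<Rightarrow> real" where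
  "triangle_const r = 1 / 4 ^ r"

text \<open>The first factor accounts for the number of midpoints compared with
  \<open>n choose r\<close>, the second for replacing the degree by
  \<open>(n - 3 * r) choose (r - s)\<close> in each of the \<open>2 * r\<close> steps.\<close>

definition doeblin_const :: "nat \<Rightarrow> real" where
  "doeblin_const r = (1 / 2) ^ r * triangle_const r ^ (2 * r)"

lemma triangle_const: "0 < triangle_const r" "triangle_const r \<le> 1"
  by (auto simp: triangle_const_def)

lemma doeblin_const: "0 < doeblin_const r" "0 < r \<Longrightarrow> doeblin_const r < 1"
proof -
  show "0 < doeblin_const r" by (simp add: doeblin_const_def triangle_const)
  assume "0 < r"
  have "doeblin_const r \<le> (1 / 2) ^ r * 1"
    unfolding doeblin_const_def using triangle_const[of r]
    by (intro mult_left_mono power_le_one) auto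
  also have "\<dots> < 1" using \<open>0 < r\<close> by (simp add: power_less_one_iff)
  finally show "doeblin_const r < 1" .
qed

abbreviation (input) johnson_degree :: "nat \<Rightarrow> nat \<Rightarrow> nat \<Rightarrow> nat" where
  "johnson_degree n r s \<equiv> (r choose s) * ((n - r) choose (r - s))"

text \<open>One factor \<open>2 ^ r\<close> bounds \<open>r choose s\<close>, the other pays for
  passing from \<open>n\<close> to \<open>n - 3 * r\<close>, where \<open>7 * r \<le> n\<close> is
  used.\<close>

lemma johnson_degree_le:
  assumes "s < r" "7 * r \<le> n"
  shows "triangle_const r * johnson_degree n r s \<le> (n - 3 * r) choose (r - s)"
proof -
  let ?b = "real ((n - 3 * r) choose (r - s))"
  have "real ((n - r) choose (r - s)) \<le> real (n choose (r - s))"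
    by (intro of_nat_mono binomial_right_mono) simp
  also have "\<dots> \<le> 2 ^ (r - s) * ?b"
    using assms by (intro binomial_le_binomial_diff) auto
  also have "\<dots> \<le> 2 ^ r * ?b"
    by (intro mult_right_mono power_increasing) auto
  finally have "real (johnson_degree n r s) \<le> 2 ^ r * (2 ^ r * ?b)"
    unfolding of_nat_mult using binomial_le_pow2[of r s]
    by (intro mult_mono) (auto simp: numeral_power_le_of_nat_cancel_iff simp flip: of_nat_power_le_of_nat_cancel_iff)
  also have "\<dots> = 4 ^ r * ?b"
    by (simp add: power_mult_distrib[symmetric] flip: mult.assoc)
  finally show ?thesis
    by (simp add: triangle_const_def field_simps)
qed

text \<open>All constants depend on \<open>r\<close> alone, which makes the resulting bounds uniform
  in \<open>n\<close>.\<close>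

lemma mixing_graph_johnson:
  assumes "s < r" "7 * r \<le> n"
  shows "mixing_graph (johnson_verts n r) (johnson_adj s) (johnson_degree n r s) (2 * r)
    (doeblin_const r) (triangle_const r)"
proof
  let ?V = "johnson_verts n r" and ?d = "johnson_degree n r s" and ?N = "n choose r"
  let ?b = "(n - 3 * r) choose (r - s)" and ?c = "triangle_const r"
  note card = card_johnson_verts[of n r]
  have N: "0 < ?N" using assms by simp
  show "finite ?V" by (rule finite_johnson_verts)
  show "?V \<noteq> {}" using N card by (metis card.empty less_irrefl)
  show "0 < ?d" using assms by simp
  show "0 < 2 * r" using assms by simp
  show "0 < doeblin_const r" "doeblin_const r < 1" "0 < ?c" "?c \<le> 1"
    using assms doeblin_const triangle_const by auto
  show "johnson_adj s y x" if "johnson_adj s x y" for x y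
    using that by (simp add: johnson_adj_def Int_commute)
  show "\<not> johnson_adj s x x" if "x \<in> ?V" for x
    using that assms by (simp add: johnson_adj_def johnson_verts_def)
  show "card {y \<in> ?V. johnson_adj s x y} = ?d" if "x \<in> ?V" for x
    using that assms by (intro card_johnson_nbrs) auto
  show "nwalks ?V (johnson_adj s) k x x = nwalks ?V (johnson_adj s) k y y"
    if "x \<in> ?V" "y \<in> ?V" for x y k
    using that by (rule johnson_walks_homogeneous)
  show "?c * real ?d \<le> real (nwalks ?V (johnson_adj s) 2 x y)"
    if "x \<in> ?V" "y \<in> ?V" "johnson_adj s x y" for x y
    using johnson_walks_codegree[OF assms(1) that] johnson_degree_le[OF assms] by linarith
  show "doeblin_const r / real (card ?V) * real ?d ^ (2 * r)
      \<le> real (nwalks ?V (johnson_adj s) (2 * r) x y)"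
    if "x \<in> ?V" "y \<in> ?V" for x y
  proof -
    let ?w = "real (nwalks ?V (johnson_adj s) (2 * r) x y)"
    have "real ?N \<le> 2 ^ r * real ((n - 2 * r) choose r)"
      using assms by (intro binomial_le_binomial_diff) auto
    then have 1: "(1 / 2) ^ r * real ?N \<le> real ((n - 2 * r) choose r)"
      by (simp add: power_one_over field_simps)
    have 2: "(?c * real ?d) ^ (2 * r) \<le> real ?b ^ (2 * r)"
      using johnson_degree_le[OF assms] triangle_const[of r] by (intro power_mono) auto
    have "real ?N * (doeblin_const r * real ?d ^ (2 * r))
        = (1 / 2) ^ r * real ?N * (?c * real ?d) ^ (2 * r)"
      by (simp add: doeblin_const_def power_mult_distrib)
    also have "\<dots> \<le> real ((n - 2 * r) choose r) * real ?b ^ (2 * r)"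
      using 1 2 triangle_const[of r] by (intro mult_mono) auto
    also have "\<dots> = real (((n - 2 * r) choose r) * (?b ^ r) ^ 2)"
      by (simp add: power_mult[symmetric] mult.commute)
    also have "\<dots> \<le> real (?N ^ 2 * nwalks ?V (johnson_adj s) (2 * r) x y)"
      using johnson_walks_minor[OF assms(1) that] by (rule of_nat_mono)
    also have "\<dots> = real ?N * (real ?N * ?w)"
      by (simp add: power2_eq_square)
    finally have "doeblin_const r * real ?d ^ (2 * r) \<le> real ?N * ?w"
      using N by simp
    then show ?thesis using N by (simp add: card field_simps)
  qed
qed

text \<open>The rate \<open>\<gamma>\<close> of the locale for these parameters, written without the
  locale so that it can be used while \<open>n\<close> varies.\<close>

definition mixing_rate :: "nat \<Rightarrow> real" where
  "mixing_rate r = root (2 * r) (1 - doeblin_const r)"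

lemma mixing_rate:
  assumes "0 < r" shows "0 < mixing_rate r" "mixing_rate r < 1"
  using assms doeblin_const[of r] by (auto simp: mixing_rate_def)

definition mon_ratio :: "nat \<Rightarrow> nat \<Rightarrow> nat \<Rightarrow> nat \<Rightarrow> real" where
  "mon_ratio r s n t =
    real (mon_count (cycle_verts t) (cycle_adj t) (johnson_verts n r) (johnson_adj s))
    / real (hom_count (cycle_verts t) (cycle_adj t) (johnson_verts n r) (johnson_adj s))"

section \<open>Transfer of the cycle bounds to Johnson graphs\<close>

context
  fixes r s n t :: nat
  assumes rs: "s < r" and n: "7 * r \<le> n" and t: "3 \<le> t"
begin

interpretation mixing_graph "johnson_verts n r" "johnson_adj s" "johnson_degree n r s" "2 * r"
  "doeblin_const r" "triangle_const r"
  by (rule mixing_graph_johnson[OF rs n])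

lemma johnson_N: "N = real (n choose r)"
  by (simp add: N_def card_johnson_verts)

lemma johnson_\<gamma>: "\<gamma> = mixing_rate r"
  by (simp add: \<gamma>_def mixing_rate_def)

lemma mon_ratio_le_1: "mon_ratio r s n t \<le> 1"
  using mon_le_hom[of t] hom_pos[of t] t by (simp add: mon_ratio_def)

lemma mon_ratio_johnson_ge_short:
  "1 - (real t)\<^sup>2 / (triangle_const r ^ 4 * johnson_degree n r s) \<le> mon_ratio r s n t"
  unfolding mon_ratio_def by (rule mon_ratio_ge_short[OF t])

lemma mon_ratio_johnson_ge_long:
  assumes "real (n choose r) * mixing_rate r ^ (t div 2) \<le> 1 / 2 * (1 - doeblin_const r)"
  shows "1 - 8 * ((real t)\<^sup>2 / real (n choose r)
      + real t / ((1 - doeblin_const r) * (1 - mixing_rate r) * johnson_degree n r s))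
    \<le> mon_ratio r s n t"
  using mon_ratio_ge_long[OF t] assms unfolding johnson_N johnson_\<gamma> mon_ratio_def by simp

lemma mon_ratio_johnson_le_degree:
  assumes "real (n choose r) * mixing_rate r ^ (t div 2) \<le> \<eta> * (1 - doeblin_const r)"
    and \<eta>: "0 < \<eta>" "\<eta> < 1" and "6 \<le> t"
  shows "mon_ratio r s n t
    \<le> exp (- (real t / (4 * real (johnson_degree n r s)))) * ((1 + \<eta>) / (1 - \<eta>))"
proof -
  let ?d = "johnson_degree n r s"
  \<comment> \<open>\<open>saw_le_exp_degree\<close> speaks of \<open>Suc L\<close> edges, here half
    of the cycle; \<open>6 \<le> t\<close> ensures that \<open>L\<close> is still at least
    \<open>t / 4\<close>.\<close>
  define L where "L = t div 2 - 1"
  have L: "Suc L = t div 2" "real t / 4 \<le> real L"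
    using \<open>6 \<le> t\<close> by (auto simp: L_def)
  have "real t / (4 * real ?d) \<le> real L / ?d"
    using divide_right_mono[OF L(2), of "real ?d"] by simp
  then have "N * real ?d ^ Suc L * exp (- (L / ?d)) \<le> N * real ?d ^ Suc L * exp (- (real t / (4 * real ?d)))"
    using N_pos by (intro mult_left_mono) auto
  with saw_le_exp_degree[of L]
  have "real (saw (Suc L)) \<le> N * real ?d ^ Suc L * exp (- (real t / (4 * real ?d)))" by linarith
  moreover have "t div 2 \<le> t - Suc L" using L(1) by linarith
  ultimately show ?thesis
    unfolding mon_ratio_def using t assms L(1)
    by (intro mon_ratio_le[of t \<eta> "Suc L"]) (simp_all add: johnson_N johnson_\<gamma>)
qed

lemma mon_ratio_johnson_le_verts:
  assumes "real (n choose r) * mixing_rate r ^ (t div 2) \<le> \<eta> * (1 - doeblin_const r)"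
    and \<eta>: "0 < \<eta>" "\<eta> < 1" and "16 * r \<le> t" "6 \<le> t"
  shows "mon_ratio r s n t
    \<le> exp (- (doeblin_const r * (real t)\<^sup>2 / (128 * r * real (n choose r)))) * ((1 + \<eta>) / (1 - \<eta>))"
proof -
  let ?d = "johnson_degree n r s"
  \<comment> \<open>At most a quarter of the cycle goes into the first \<open>M\<close> steps and at
    most another quarter into \<open>q\<close> blocks of \<open>2 * r\<close> steps. The bounds
    \<open>t / 8\<close> for \<open>M\<close> and \<open>t / (16 * r)\<close> for \<open>q\<close>
    produce the constant 128.\<close>
  define M where "M = t div 4"
  define q where "q = t div (8 * r)"
  have M: "real t / 8 \<le> real M" "0 < M" using \<open>6 \<le> t\<close> by (auto simp: M_def)
  have "t < (q + 1) * (8 * r)"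
    unfolding q_def using rs by (simp add: dividend_less_div_times)
  then have "real t < real ((q + 1) * (8 * r))"
    by (rule of_nat_less_iff[THEN iffD2])
  then have q: "real t / (16 * r) \<le> real q"
    using \<open>16 * r \<le> t\<close> rs by (simp add: field_simps)
  have "q * (8 * r) \<le> t" unfolding q_def by (rule div_times_less_eq_dividend)
  then have L: "M + q * (2 * r) \<le> t div 2"
    unfolding M_def by linarith
  have "(real t / 8) * (real t / (16 * r)) \<le> real M * real q"
    using M(1) q by (rule mult_mono) auto
  then have "doeblin_const r * ((real t / 8) * (real t / (16 * r))) / N
      \<le> doeblin_const r * (real M * real q) / N"
    using N_pos doeblin_const(1)[of r] by (intro divide_right_mono mult_left_mono) auto
  then have "doeblin_const r * (real t)\<^sup>2 / (128 * r * N) \<le> doeblin_const r * M * q / N"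
    by (simp add: power2_eq_square mult_ac)
  then have "N * real ?d ^ (M + q * (2 * r)) * exp (- (doeblin_const r * M * q / N))
      \<le> N * real ?d ^ (M + q * (2 * r)) * exp (- (doeblin_const r * (real t)\<^sup>2 / (128 * r * N)))"
    using N_pos by (intro mult_left_mono) auto
  with saw_le_exp_verts[OF M(2), of q]
  have "real (saw (M + q * (2 * r))) \<le> N * real ?d ^ (M + q * (2 * r))
      * exp (- (doeblin_const r * (real t)\<^sup>2 / (128 * r * N)))" by linarith
  moreover have "t div 2 \<le> t - (M + q * (2 * r))" using L by linarith
  ultimately show ?thesis
    unfolding mon_ratio_def using t assms L
    by (intro mon_ratio_le[of t \<eta> "M + q * (2 * r)"]) (simp_all add: johnson_N johnson_\<gamma>)
qed

end

section \<open>Asymptotics\<close>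

text \<open>Linear growth suffices later: it comes from bounding \<open>a choose k\<close> below by
  \<open>(a / k) ^ k\<close> and hence by \<open>a / k\<close>.\<close>

lemma johnson_growth:
  assumes "s < r" "7 * r \<le> n"
  shows "real n / (2 * r) \<le> real (n choose r)" "real n / (2 * r) \<le> real (johnson_degree n r s)"
proof -
  have ge: "real a / real k \<le> real (a choose k)" if "0 < k" "k \<le> a" for a k
  proof -
    have "real a / real k \<le> (real a / real k) ^ k"
      using that power_increasing[of 1 k "real a / real k"] by simp
    also have "\<dots> \<le> real (a choose k)"
      using that by (intro binomial_ge_n_over_k_pow_k)
    finally show ?thesis .
  qed
  have "real n / (2 * r) \<le> real n / r" using assms by (intro divide_left_mono) auto
  then show "real n / (2 * r) \<le> real (n choose r)"
    using ge[of r n] assms by linarith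
  have "real n / (2 * r) \<le> real (n - r) / r"
    using assms by (simp add: field_simps of_nat_diff)
  also have "\<dots> \<le> real (n - r) / real (r - s)"
    using assms by (intro divide_left_mono) auto
  also have "\<dots> \<le> real ((n - r) choose (r - s))"
    using assms by (intro ge) auto
  also have "\<dots> \<le> real (johnson_degree n r s)"
  proof -
    have "1 \<le> r choose s" using assms by (simp add: Suc_le_eq)
    then show ?thesis by (intro of_nat_mono) simp
  qed
  finally show "real n / (2 * r) \<le> real (johnson_degree n r s)" .
qed

text \<open>Once t exceeds the cube root of n, it exceeds every mixing time, which is of order log n.\<close>

lemma eventually_mixed:
  fixes \<gamma> \<epsilon> :: real
  assumes \<gamma>: "0 < \<gamma>" "\<gamma> < 1" and "0 < \<epsilon>"
  shows "\<forall>\<^sub>F n in sequentially. \<forall>t. n < t ^ 3 \<longrightarrow> real (n choose r) * \<gamma> ^ (t div 2) \<le> \<epsilon>"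
proof -
  \<comment> \<open>This root puts the growth of \<open>n choose r\<close>, which is below
    \<open>t ^ (3 * r + 1)\<close>, and the decay of \<open>\<gamma> ^ (t div 2)\<close> under the
    same exponent, so that it suffices that \<open>t * \<delta> ^ t\<close> tends to 0.\<close>
  define \<delta> where "\<delta> = root (3 * r + 1) (sqrt \<gamma>)"
  have \<delta>: "0 < \<delta>" "\<delta> < 1" and \<delta>_pow: "\<delta> ^ (3 * r + 1) = sqrt \<gamma>"
    using \<gamma> by (auto simp: \<delta>_def simp del: power_Suc)
  have "(\<lambda>t. real t * \<delta> ^ t) \<longlonglongrightarrow> 0"
    using powser_times_n_limit_0[of \<delta>] \<delta> by simp
  then have "(\<lambda>t. (real t * \<delta> ^ t) ^ (3 * r + 1) / sqrt \<gamma>) \<longlonglongrightarrow> 0 ^ (3 * r + 1) / sqrt \<gamma>"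
    using \<gamma> by (intro tendsto_intros) auto
  then have "\<forall>\<^sub>F t in sequentially. (real t * \<delta> ^ t) ^ (3 * r + 1) / sqrt \<gamma> < \<epsilon>"
    using \<open>0 < \<epsilon>\<close> by (intro order_tendstoD(2)) auto
  then obtain T where T: "\<And>t. T \<le> t \<Longrightarrow> (real t * \<delta> ^ t) ^ (3 * r + 1) / sqrt \<gamma> < \<epsilon>"
    by (auto simp: eventually_sequentially)
  show ?thesis
    unfolding eventually_sequentially
  proof (intro exI[of _ "max r (T ^ 3)"] allI impI)
    fix n t assume n: "max r (T ^ 3) \<le> n" and t: "n < t ^ 3"
    then have "T ^ 3 < t ^ 3" by simp
    then have "T < t" using power_less_imp_less_base[of T 3 t] by simp
    then have t1: "1 \<le> t" by simp
    have "n choose r \<le> n ^ r" using n by (intro binomial_le_pow) simp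
    also have "\<dots> \<le> (t ^ 3) ^ r" using t by (intro power_mono) auto
    also have "\<dots> \<le> t ^ (3 * r + 1)" using t1 by (simp add: power_mult)
    finally have "n choose r \<le> t ^ (3 * r + 1)" .
    then have 1: "real (n choose r) \<le> real t ^ (3 * r + 1)"
      unfolding of_nat_power[symmetric] by (rule of_nat_mono)
    \<comment> \<open>The extra \<open>sqrt \<gamma>\<close> makes up for the rounding in
      \<open>t div 2\<close>.\<close>
    have "sqrt \<gamma> * \<gamma> ^ (t div 2) = sqrt \<gamma> ^ (2 * (t div 2) + 1)"
      using \<gamma> by (simp add: power_mult)
    also have "\<dots> \<le> sqrt \<gamma> ^ t"
      using \<gamma> by (intro power_decreasing) auto
    also have "\<dots> = (\<delta> ^ t) ^ (3 * r + 1)"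
      unfolding \<delta>_pow[symmetric] by (simp only: power_mult[symmetric] mult.commute)
    finally have "\<gamma> ^ (t div 2) \<le> (\<delta> ^ t) ^ (3 * r + 1) / sqrt \<gamma>"
      using \<gamma> by (simp add: pos_le_divide_eq mult.commute)
    then have "real (n choose r) * \<gamma> ^ (t div 2)
        \<le> real t ^ (3 * r + 1) * ((\<delta> ^ t) ^ (3 * r + 1) / sqrt \<gamma>)"
      using 1 \<gamma> by (intro mult_mono) auto
    also have "\<dots> = (real t * \<delta> ^ t) ^ (3 * r + 1) / sqrt \<gamma>"
      by (simp only: power_mult_distrib times_divide_eq_right)
    also have "\<dots> < \<epsilon>" using T[of t] \<open>T < t\<close> by simp
    finally show "real (n choose r) * \<gamma> ^ (t div 2) \<le> \<epsilon>" by simp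
  qed
qed

abbreviation (input) threshold :: "nat \<Rightarrow> nat \<Rightarrow> nat \<Rightarrow> real" where
  "threshold r s n \<equiv> min (sqrt (real (n choose r))) (real (johnson_degree n r s))"

text \<open>The square of the threshold is the minimum of \<open>n choose r\<close> and the squared
  degree, and the latter is at least the degree. Any \<open>t\<close> of the order of the threshold
  is therefore at least of order \<open>sqrt n\<close>, far beyond the cube root.\<close>

lemma threshold_sq_ge:
  assumes "s < r" "7 * r \<le> n"
  shows "real n / (2 * r) \<le> (threshold r s n)\<^sup>2" "0 < threshold r s n"
proof -
  note growth = johnson_growth[OF assms]
  have "1 \<le> johnson_degree n r s" using assms by (simp add: Suc_le_eq)
  then have "1 \<le> real (johnson_degree n r s)" by (metis of_nat_1 of_nat_le_iff)
  then have "real (johnson_degree n r s) \<le> (real (johnson_degree n r s))\<^sup>2"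
    by (simp add: self_le_power)
  with growth show "real n / (2 * r) \<le> (threshold r s n)\<^sup>2"
    by (simp add: min_def)
  show "0 < threshold r s n" using assms by simp
qed

text \<open>The bound is uniform in \<open>t\<close>, so a sequence \<open>t n\<close> may change
  between short and long cycles at will.\<close>

lemma mon_ratio_ge_threshold:
  assumes "s < r"
  shows "\<exists>A B. \<forall>\<^sub>F n in sequentially. \<forall>t \<ge> 3.
    1 - (A / root 3 n + 8 * ((real t / threshold r s n)\<^sup>2 + B * (real t / threshold r s n)))
      \<le> mon_ratio r s n t"
proof -
  let ?c = "triangle_const r" and ?\<alpha> = "doeblin_const r" and ?\<gamma> = "mixing_rate r"
  define A where "A = 2 * r / ?c ^ 4"
  define B where "B = 1 / ((1 - ?\<alpha>) * (1 - ?\<gamma>))"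
  have r: "0 < r" using assms by simp
  note \<alpha> = doeblin_const(1)[of r] doeblin_const(2)[OF r] and \<gamma> = mixing_rate[OF r]
  have AB: "0 \<le> A" "0 \<le> B" using triangle_const[of r] \<alpha> \<gamma> by (auto simp: A_def B_def)
  have "0 < 1 / 2 * (1 - ?\<alpha>)" using \<alpha> by simp
  from eventually_mixed[OF \<gamma> this, of r]
  have "\<forall>\<^sub>F n in sequentially. \<forall>t \<ge> 3.
    1 - (A / root 3 n + 8 * ((real t / threshold r s n)\<^sup>2 + B * (real t / threshold r s n)))
      \<le> mon_ratio r s n t"
    using eventually_ge_at_top[of "7 * r"]
  proof eventually_elim
    case (elim n)
    let ?N = "real (n choose r)" and ?d = "real (johnson_degree n r s)"
    let ?h = "threshold r s n"
    have h: "0 < ?h" by (rule threshold_sq_ge(2)[OF assms elim(2)])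
    have n_pos: "0 < n" using elim(2) r by simp
    show ?case
    proof (intro allI impI)
      fix t :: nat assume t: "3 \<le> t"
      show "1 - (A / root 3 n + 8 * ((real t / ?h)\<^sup>2 + B * (real t / ?h))) \<le> mon_ratio r s n t"
      \<comment> \<open>The short bound needs \<open>t\<close> well below \<open>sqrt n\<close>, the
        long one needs \<open>t\<close> well above \<open>log n\<close>; the cube root lies
        between.\<close>
      proof (cases "t ^ 3 \<le> n")
        case True
        define \<rho> where "\<rho> = root 3 (real n)"
        have \<rho>: "0 < \<rho>" "\<rho> ^ 3 = real n" using n_pos by (auto simp: \<rho>_def)
        have "real t ^ 3 \<le> \<rho> ^ 3"
          unfolding \<rho>(2) using True by (simp flip: of_nat_power)
        then have t\<rho>: "real t \<le> \<rho>" using \<rho> power_le_imp_le_base[of "real t" 2 \<rho>] by (simp add: numeral_3_eq_3)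
        have d: "\<rho> ^ 3 / (2 * r) \<le> ?d" using johnson_growth(2)[OF assms elim(2)] \<rho>(2) by simp
        have "(real t)\<^sup>2 / (?c ^ 4 * ?d) \<le> \<rho>\<^sup>2 / (?c ^ 4 * (\<rho> ^ 3 / (2 * r)))"
          using t\<rho> d \<rho> r n_pos triangle_const[of r]
          by (intro frac_le power_mono mult_left_mono) auto
        also have "\<dots> = A / \<rho>"
          using \<rho>(1) by (simp add: A_def power2_eq_square power3_eq_cube)
        finally have "1 - A / \<rho> \<le> mon_ratio r s n t"
          using mon_ratio_johnson_ge_short[OF assms elim(2) t] by linarith
        moreover have "0 \<le> 8 * ((real t / ?h)\<^sup>2 + B * (real t / ?h))"
          using AB h by simp
        ultimately show ?thesis by (simp add: \<rho>_def)
      next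
        case False
        have N: "(real t)\<^sup>2 / ?N \<le> (real t / ?h)\<^sup>2"
        proof -
          have "?h\<^sup>2 \<le> (sqrt ?N)\<^sup>2" using h by (intro power_mono) auto
          then have le: "?h\<^sup>2 \<le> ?N" by simp
          show ?thesis
            unfolding power_divide by (rule frac_le[OF _ order_refl zero_less_power[OF h] le]) simp
        qed
        have "real t / ?d \<le> real t / ?h"
          by (rule frac_le[OF _ order_refl h]) simp_all
        then have D: "B * (real t / ?d) \<le> B * (real t / ?h)"
          using AB by (intro mult_left_mono)
        have "1 - (A / root 3 n + 8 * ((real t / ?h)\<^sup>2 + B * (real t / ?h)))
            \<le> 1 - (0 + 8 * ((real t)\<^sup>2 / ?N + B * (real t / ?d)))"
          using AB by (intro diff_mono add_mono mult_left_mono order_refl N D) auto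
        also have "\<dots> = 1 - 8 * ((real t)\<^sup>2 / ?N + real t / ((1 - ?\<alpha>) * (1 - ?\<gamma>) * ?d))"
          by (simp add: B_def)
        also have "\<dots> \<le> mon_ratio r s n t"
          using False elim(1) by (intro mon_ratio_johnson_ge_long[OF assms elim(2) t]) auto
        finally show ?thesis .
      qed
    qed
  qed
  then show ?thesis by blast
qed

text \<open>The bound \<open>q\<close> depends on \<open>\<epsilon>\<close> but not on
  \<open>n\<close> or \<open>t\<close>, which contradicts convergence to 1 if \<open>t\<close>
  reaches \<open>\<epsilon>\<close> times the threshold infinitely often.\<close>

lemma mon_ratio_bounded_away:
  assumes "s < r" and \<epsilon>: "0 < \<epsilon>"
  shows "\<exists>q < 1. \<forall>\<^sub>F n in sequentially. \<forall>t \<ge> 3.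
    \<epsilon> * threshold r s n \<le> real t \<longrightarrow> mon_ratio r s n t \<le> q"
proof -
  let ?\<alpha> = "doeblin_const r" and ?\<gamma> = "mixing_rate r"
  have r: "0 < r" using assms by simp
  note \<alpha> = doeblin_const(1)[of r] doeblin_const(2)[OF r] and \<gamma> = mixing_rate[OF r]
  \<comment> \<open>The two entries are the exponents obtained from
    \<open>mon_ratio_johnson_le_degree\<close> and \<open>mon_ratio_johnson_le_verts\<close> at
    \<open>t\<close> equal to \<open>\<epsilon>\<close> times the degree and
    \<open>\<epsilon>\<close> times \<open>sqrt N\<close>.\<close>
  define \<kappa> where "\<kappa> = min (\<epsilon> / 4) (?\<alpha> * \<epsilon>\<^sup>2 / (128 * r))"
  define e where "e = exp (- \<kappa>)"
  \<comment> \<open>With this \<open>\<eta>\<close>, the condition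
    \<open>e * (1 + \<eta>) < 1 - \<eta>\<close> becomes
    \<open>0 < (1 - e) * (3 - e)\<close>.\<close>
  define \<eta> where "\<eta> = (1 - e) / 4"
  define q where "q = e * ((1 + \<eta>) / (1 - \<eta>))"
  have "0 < \<kappa>" using \<epsilon> \<alpha> r by (simp add: \<kappa>_def)
  then have e: "0 < e" "e < 1" by (auto simp: e_def)
  then have \<eta>: "0 < \<eta>" "\<eta> < 1" by (auto simp: \<eta>_def)
  have "q < 1"
  proof -
    have "0 < (1 - e) * (3 - e)" using e by simp
    then have "e * (1 + \<eta>) < 1 - \<eta>" by (simp add: \<eta>_def field_simps)
    then show ?thesis using \<eta> by (simp add: q_def)
  qed
  have "0 < \<eta> * (1 - ?\<alpha>)" using \<eta> \<alpha> by simp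
  from eventually_mixed[OF \<gamma> this, of r]
  have "\<forall>\<^sub>F n in sequentially. \<forall>t \<ge> 3.
    \<epsilon> * threshold r s n \<le> real t \<longrightarrow> mon_ratio r s n t \<le> q"
    using eventually_ge_at_top[of "7 * r"] eventually_ge_at_top[of "(16 * r + 6) ^ 3"]
      eventually_gt_at_top[of "nat \<lceil>(2 * r / \<epsilon>\<^sup>2) ^ 3\<rceil>"]
  proof eventually_elim
    case (elim n)
    let ?N = "real (n choose r)" and ?d = "real (johnson_degree n r s)"
    let ?h = "threshold r s n"
    note h = threshold_sq_ge[OF assms(1) elim(2)]
    have n_large: "(2 * r / \<epsilon>\<^sup>2) ^ 3 < real n"
      using elim(4) by linarith
    have pos: "0 < ?N" "0 < ?d" using h(2) by auto
    show ?case
    proof (intro allI impI)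
      fix t :: nat assume t3: "3 \<le> t" and t: "\<epsilon> * ?h \<le> real t"
      have tsq: "\<epsilon>\<^sup>2 * ?h\<^sup>2 \<le> (real t)\<^sup>2"
        using power_mono[OF t, of 2] h(2) \<epsilon> by (simp add: power_mult_distrib)
      \<comment> \<open>Otherwise \<open>t ^ 3 \<le> n\<close> together with \<open>n\<close> being
        at most a constant times the square of \<open>t\<close> would bound \<open>t\<close>, and
        then \<open>n\<close>, by constants.\<close>
      have long: "n < t ^ 3"
      proof (rule ccontr)
        assume "\<not> n < t ^ 3"
        then have le: "real t ^ 3 \<le> real n" by (simp flip: of_nat_power)
        have "\<epsilon>\<^sup>2 * (real n / (2 * r)) \<le> (real t)\<^sup>2"
          using mult_left_mono[OF h(1), of "\<epsilon>\<^sup>2"] tsq by simp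
        then have n_le: "real n \<le> 2 * r / \<epsilon>\<^sup>2 * (real t)\<^sup>2"
          using \<epsilon> r by (simp add: field_simps)
        with le have "real t * (real t)\<^sup>2 \<le> 2 * r / \<epsilon>\<^sup>2 * (real t)\<^sup>2"
          by (simp add: power2_eq_square power3_eq_cube)
        then have "real t \<le> 2 * r / \<epsilon>\<^sup>2"
          by (rule mult_right_le_imp_le) (use t3 in simp)
        then have "2 * r / \<epsilon>\<^sup>2 * (real t)\<^sup>2 \<le> 2 * r / \<epsilon>\<^sup>2 * (2 * r / \<epsilon>\<^sup>2)\<^sup>2"
          by (intro mult_left_mono power_mono) auto
        with n_le n_large show False
          by (simp add: power2_eq_square power3_eq_cube)
      qed
      with elim(3) have "(16 * r + 6) ^ 3 < t ^ 3" by linarith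
      then have "16 * r + 6 < t"
        by (rule power_less_imp_less_base) simp
      then have big: "16 * r \<le> t" "6 \<le> t" by auto
      have mix: "?N * ?\<gamma> ^ (t div 2) \<le> \<eta> * (1 - ?\<alpha>)" using elim(1) long by blast
      have fac: "0 \<le> (1 + \<eta>) / (1 - \<eta>)" using \<eta> by simp
      show "mon_ratio r s n t \<le> q"
      \<comment> \<open>Whichever quantity is the minimum decides which self-avoidance estimate
        applies.\<close>
      proof (cases "sqrt ?N \<le> ?d")
        case True
        then have "\<epsilon>\<^sup>2 * ?N \<le> (real t)\<^sup>2" using tsq by (simp add: min_def)
        then have "?\<alpha> * (\<epsilon>\<^sup>2 * ?N) / (128 * r * ?N) \<le> ?\<alpha> * (real t)\<^sup>2 / (128 * r * ?N)"
          using \<alpha> by (intro divide_right_mono mult_left_mono) auto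
        then have "?\<alpha> * \<epsilon>\<^sup>2 / (128 * r) \<le> ?\<alpha> * (real t)\<^sup>2 / (128 * r * ?N)"
          using pos by simp
        then have "exp (- (?\<alpha> * (real t)\<^sup>2 / (128 * r * ?N))) \<le> e"
          by (simp add: e_def \<kappa>_def)
        from order_trans[OF mon_ratio_johnson_le_verts[OF assms(1) elim(2) t3 mix \<eta> big]
            mult_right_mono[OF this fac]]
        show ?thesis by (simp only: q_def)
      next
        case False
        then have "\<epsilon> * ?d \<le> real t" using t by (simp add: min_def)
        then have "\<epsilon> \<le> real t / ?d"
          by (simp only: pos_le_divide_eq[OF pos(2)])
        moreover have "real t / (4 * ?d) = real t / ?d / 4"
          by (simp only: divide_divide_eq_left mult.commute)
        ultimately have "\<epsilon> / 4 \<le> real t / (4 * ?d)" by linarith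
        then have "exp (- (real t / (4 * ?d))) \<le> e"
          by (simp add: e_def \<kappa>_def)
        from order_trans[OF mon_ratio_johnson_le_degree[OF assms(1) elim(2) t3 mix \<eta> big(2)]
            mult_right_mono[OF this fac]]
        show ?thesis by (simp only: q_def)
      qed
    qed
  qed
  with \<open>q < 1\<close> show ?thesis by blast
qed

theorem theorem2:
  fixes r s :: nat and t :: "nat \<Rightarrow> nat"
  assumes "s < r" and "\<And>n. t n \<ge> 3"
  shows "((\<lambda>n. real (mon_count (cycle_verts (t n)) (cycle_adj (t n)) (johnson_verts n r) (johnson_adj s))
              / real (hom_count (cycle_verts (t n)) (cycle_adj (t n)) (johnson_verts n r) (johnson_adj s)))
           \<longlongrightarrow> 1) sequentially
     \<longleftrightarrow> ((\<lambda>n. real (t n) / min (sqrt (real (n choose r))) (real ((r choose s) * ((n - r) choose (r - s)))))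
           \<longlongrightarrow> 0) sequentially"
    (is "?mon \<longleftrightarrow> ?u")
proof
  assume ?u
  obtain A B where AB: "\<forall>\<^sub>F n in sequentially. \<forall>t \<ge> 3.
    1 - (A / root 3 n + 8 * ((real t / threshold r s n)\<^sup>2 + B * (real t / threshold r s n)))
      \<le> mon_ratio r s n t"
    using mon_ratio_ge_threshold[OF assms(1)] by blast
  have "filterlim (\<lambda>n. root 3 (real n)) at_top sequentially"
    by (rule filterlim_compose[OF _ filterlim_real_sequentially]) real_asymp
  then have "(\<lambda>n. A / root 3 (real n)) \<longlonglongrightarrow> 0"
    by (intro tendsto_divide_0[OF tendsto_const] filterlim_at_top_imp_at_infinity)
  then have "(\<lambda>n. 1 - (A / root 3 n + 8 * ((real (t n) / threshold r s n)\<^sup>2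
      + B * (real (t n) / threshold r s n)))) \<longlonglongrightarrow> 1 - (0 + 8 * (0\<^sup>2 + B * 0))"
    using \<open>?u\<close> by (intro tendsto_intros)
  then have lower: "(\<lambda>n. 1 - (A / root 3 n + 8 * ((real (t n) / threshold r s n)\<^sup>2
      + B * (real (t n) / threshold r s n)))) \<longlonglongrightarrow> 1"
    by simp
  \<comment> \<open>All error terms of the lower bound vanish by assumption, and monomorphisms never
    outnumber homomorphisms.\<close>
  have "(\<lambda>n. mon_ratio r s n (t n)) \<longlonglongrightarrow> 1"
  proof (rule tendsto_sandwich[OF _ _ lower tendsto_const])
    show "\<forall>\<^sub>F n in sequentially. 1 - (A / root 3 n + 8 * ((real (t n) / threshold r s n)\<^sup>2
      + B * (real (t n) / threshold r s n))) \<le> mon_ratio r s n (t n)"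
      using AB by eventually_elim (use assms(2) in blast)
    show "\<forall>\<^sub>F n in sequentially. mon_ratio r s n (t n) \<le> 1"
      using eventually_ge_at_top[of "7 * r"]
      by eventually_elim (rule mon_ratio_le_1[OF assms(1) _ assms(2)])
  qed
  then show ?mon by (simp add: mon_ratio_def)
next
  assume ?mon
  then have ratio: "(\<lambda>n. mon_ratio r s n (t n)) \<longlonglongrightarrow> 1" by (simp add: mon_ratio_def)
  have "(\<lambda>n. real (t n) / threshold r s n) \<longlonglongrightarrow> 0"
  proof (rule order_tendstoI)
    fix a :: real assume "a < 0"
    moreover have "0 \<le> real (t n) / threshold r s n" for n by simp
    ultimately show "\<forall>\<^sub>F n in sequentially. a < real (t n) / threshold r s n"
      by (intro always_eventually allI) (rule less_le_trans)
  next
    fix \<epsilon> :: real assume "0 < \<epsilon>"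
    then obtain q where q: "q < 1" "\<forall>\<^sub>F n in sequentially. \<forall>t \<ge> 3.
        \<epsilon> * threshold r s n \<le> real t \<longrightarrow> mon_ratio r s n t \<le> q"
      using mon_ratio_bounded_away[OF assms(1)] by blast
    \<comment> \<open>The ratio eventually exceeds \<open>q\<close>, so \<open>t n\<close> must be
      below \<open>\<epsilon>\<close> times the threshold.\<close>
    show "\<forall>\<^sub>F n in sequentially. real (t n) / threshold r s n < \<epsilon>"
      using q(2) order_tendstoD(1)[OF ratio q(1)] eventually_ge_at_top[of "7 * r"]
    proof eventually_elim
      case (elim n)
      then have "real (t n) < \<epsilon> * threshold r s n"
        using assms(2)[of n] by (meson not_le)
      then show ?case
        using threshold_sq_ge(2)[OF assms(1) elim(3)] by (simp only: pos_divide_less_eq)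
    qed
  qed
  then show ?u by simp
qed

end
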